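(* Let $\bm{K}=\bm{K}(\tau)$, $\tau\ge 0$, be the matrix of the discontinuous Galerkin discretization with penalty flux (penalty parameter $\tau$) of the linear hyperbolic system $\frac{\partial \bm{U}}{\partial t}+\sum_{i=1}^d \bm{A}_i\frac{\partial \bm{U}}{\partial \bm{x}_i}=0$ with constant symmetric matrices $\bm{A}_i$, and let $\bm{A}$ be its conforming diagonal block (the discretization restricted to the conforming space $V^C$), all as defined in the context. Let $N^C=\dim V^C$ and $N^{NC}=\dim V^{NC}$. Then, as $\tau\to\infty$, the spectrum of $\bm{K}$ decouples into two sets of eigenvalues (counted with algebraic multiplicity): for all sufficiently large $\tau$ the eigenvalues of $\bm{K}(\tau)$ split into two disjoint sets $\{\lambda^C_1,\ldots,\lambda^C_{N^C}\}$ and $\{\lambda^{NC}_1,\ldots,\lambda^{NC}_{N^{NC}}\}$ (depending on $\tau$) such that: 1. the eigenvalues $\lambda^{NC}_1,\ldots,\lambda^{NC}_{N^{NC}}$ diverge towards the left half plane, i.e. $\mathrm{Re}(\lambda^{NC}_i)\to-\infty$ as $\tau\to\infty$, with $|\mathrm{Re}(\lambda^{NC}_i)|=O(\tau)$; 2. the eigenvalues $\lambda^C_1,\ldots,\lambda^C_{N^C}$ converge to the eigenvalues of $\bm{A}$ with rate $O(1/\tau)$; that is, if $\mu_1,\ldots,\mu_{N^C}$ are the eigenvalues of $\bm{A}$ with multiplicity, then for a suitable enumeration (for each $\tau$) $|\lambda^C_j-\mu_j|=O(1/\tau)$ as $\tau\to\infty$ for every $j$.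
   Context: Setting. $\Omega\subset\mathbb{R}^d$ is a bounded domain exactly triangulated by a finite mesh $\Omega_h$ of elements $D^k$. $\bm{A}_1,\ldots,\bm{A}_d\in\mathbb{R}^{m\times m}$ are symmetric and spatially constant. For an integer $N\ge 0$ let $P^N(D^k)$ be the polynomials of degree at most $N$ on $D^k$, and $$V=\{\bm{U}\in (L^2(\Omega))^m:\ \bm{U}|_{D^k}\in (P^N(D^k))^m\ \ \forall D^k\in\Omega_h\}.$$ All function spaces are real; eigenvalues of matrices are taken in $\mathbb{C}$. Faces, jumps, averages. On a face of an element $D^k$ with outward unit normal $\bm{n}$, $\bm{U}^-$ denotes the trace of $\bm{U}$ from $D^k$ and $\bm{U}^+$ the trace from the neighbouring element across that face (with periodic boundary conditions every face is shared by two elements; on other boundary faces $\bm{U}^+$ is a fixed exterior value depending linearly on $\bm{U}$, determined by the homogeneous boundary condition). Set $[\![\bm{U}]\!]=\bm{U}^+-\bm{U}^-$, $\{\!\{\bm{U}\}\!\}=\tfrac12(\bm{U}^++\bm{U}^-)$, and $\bm{A}_n=\sum_{i=1}^d \bm{n}_i\bm{A}_i$. Write $(\cdot,\cdot)_{D^k}$ and $\langle\cdot,\cdot\rangle_{\partial D^k}$ for the ($\mathbb{R}^m$-valued) $L^2$ inner products on $D^k$ and $\partial D^k$. DG form. The penalty flux is $(\bm{A}_n\bm{U})^*=\bm{A}_n\{\!\{\bm{U}\}\!\}-\tfrac{\tau}{2}\bm{A}_n^T\bm{A}_n[\![\bm{U}]\!]$, $\tau\ge0$. The semi-discrete DG formulation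 is $\sum_{D^k}(\partial_t\bm{U},\bm{V})_{D^k}=b(\bm{U},\bm{V})$ for all $\bm{V}\in V$, with right-hand side $\sum_{D^k}\big(\sum_i(\bm{A}_i\bm{U},\partial_{\bm{x}_i}\bm{V})_{D^k}-\langle(\bm{A}_n\bm{U})^*,\bm{V}\rangle_{\partial D^k}\big)$, written in skew-symmetric form as $$b(\bm{U},\bm{V})=\sum_{D^k\in\Omega_h}\tfrac12\sum_{i=1}^d\Big((\bm{A}_i\bm{U},\partial_{\bm{x}_i}\bm{V})_{D^k}-(\bm{A}_i\partial_{\bm{x}_i}\bm{U},\bm{V})_{D^k}\Big)+\sum_{D^k\in\Omega_h}\tfrac14\Big(\langle\{\!\{\bm{U}\}\!\},\bm{A}_n[\![\bm{V}]\!]\rangle_{\partial D^k}-\langle\bm{A}_n[\![\bm{U}]\!],\{\!\{\bm{V}\}\!\}\rangle_{\partial D^k}\Big)-\sum_{D^k\in\Omega_h}\tfrac{\tau}{4}\langle\bm{A}_n[\![\bm{U}]\!],\bm{A}_n[\![\bm{V}]\!]\rangle_{\partial D^k}.$$ This last expression is taken as the definition of $b$. Conforming and non-conforming spaces. $$V^C=\{\bm{U}\in V:\ \bm{A}_n[\![\bm{U}]\!]=0 \text{ on every face of every } D^k\in\Omega_h\},$$ and $V^{NC}$ is the $L^2(\Omega)$-orthogonal complement of $V^C$ in $V$. Matrices. Let $\{\bm{\Phi}_j\}_{j=1}^{N^C}$ and $\{\bm{\Psi}_j\}_{j=1}^{N^{NC}}$ be $L^2(\Omega)$-orthonormal bases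 of $V^C$ and $V^{NC}$. $\bm{K}=\bm{K}(\tau)$ is the matrix of $b$ in the combined basis of $V$ (entry in row $r$, column $s$ equal to $b$ evaluated at the $s$-th basis function as $\bm{U}$ and the $r$-th as $\bm{V}$), so that its eigenvalues are the $\lambda$ for which there is a nonzero (complex) coefficient vector $\bm{u}$ with $\bm{K}\bm{u}=\lambda\bm{u}$ (the $L^2$ mass matrix is the identity in this basis). $\bm{A}$ is the $N^C\times N^C$ diagonal block of $\bm{K}$ associated with $V^C$, which is independent of $\tau$: $$\bm{A}_{rs}=\tfrac12\sum_{D^k\in\Omega_h}\sum_{i=1}^d\Big((\bm{A}_i\bm{\Phi}_s,\partial_{\bm{x}_i}\bm{\Phi}_r)_{D^k}-(\bm{A}_i\partial_{\bm{x}_i}\bm{\Phi}_s,\bm{\Phi}_r)_{D^k}\Big).$$ *)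

theory Defs
  imports
    "HOL-Analysis.Analysis"
    "HOL-Library.Landau_Symbols"
    "Jordan_Normal_Form.Char_Poly"
begin

no_notation Matrix.vec_index (infixl "$" 100)
no_notation Matrix.scalar_prod (infix "\<bullet>" 70)


subsection \<open>Vector-valued $L^2$ spaces, polynomials, surface measure\<close>

definition l2_fun :: "'a measure \<Rightarrow> ('a \<Rightarrow> 'b::euclidean_space) \<Rightarrow> bool" where
  "l2_fun M f \<longleftrightarrow> f \<in> borel_measurable M \<and> integrable M (\<lambda>x. (norm (f x))\<^sup>2)"

definition l2_inner :: "'a measure \<Rightarrow> ('a \<Rightarrow> 'b::euclidean_space) \<Rightarrow> ('a \<Rightarrow> 'b) \<Rightarrow> real" where
  "l2_inner M f g = (\<integral>x. f x \<bullet> g x \<partial>M)"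

text \<open>Elements of $L^2$ are represented by functions, so a basis spans up to null sets.\<close>

definition l2_orthonormal_basis ::
  "'a measure \<Rightarrow> ('a \<Rightarrow> 'b::euclidean_space) set \<Rightarrow> nat \<Rightarrow> (nat \<Rightarrow> 'a \<Rightarrow> 'b) \<Rightarrow> bool" where
  "l2_orthonormal_basis M W n \<phi> \<longleftrightarrow>
     (\<forall>i<n. \<phi> i \<in> W) \<and>
     (\<forall>i<n. \<forall>j<n. l2_inner M (\<phi> i) (\<phi> j) = (if i = j then 1 else 0)) \<and>
     (\<forall>U\<in>W. \<exists>c. AE x in M. U x = (\<Sum>i<n. c i *\<^sub>R \<phi> i x))"

definition poly_fun_le :: "nat \<Rightarrow> (real^'d \<Rightarrow> real) set" where
  "poly_fun_le N =
     {p. \<exists>c :: ('d \<Rightarrow> nat) \<Rightarrow> real.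
           \<forall>x. p x = (\<Sum>\<alpha> | (\<Sum>i\<in>UNIV. \<alpha> i) \<le> N. c \<alpha> * (\<Prod>i\<in>UNIV. (x $ i) ^ \<alpha> i))}"

text \<open>
  The $(d-1)$-dimensional Lebesgue measure on a compact convex set \<open>F\<close> contained in a hyperplane
  with unit normal \<open>n\<close>: the measure of \<open>E \<subseteq> F\<close> is the volume of the prism \<open>E + [0,1] n\<close>.  On the
  prism over \<open>F\<close>, \<open>closest_point F\<close> is the projection along \<open>n\<close>.  For $d = 1$ this is the
  point mass at the point of \<open>F\<close>.
\<close>

definition face_measure :: "real^'d \<Rightarrow> (real^'d) set \<Rightarrow> (real^'d) measure" where
  "face_measure n F =
     distr (restrict_space lborel ((\<lambda>(y, t). y + t *\<^sub>R n) ` (F \<times> {0..1})))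
           (restrict_space borel F) (closest_point F)"

definition outward_normal :: "(real^'d) set \<Rightarrow> (real^'d) set \<Rightarrow> real^'d" where
  "outward_normal D F = (THE n. norm n = 1 \<and> (\<forall>x\<in>D. \<forall>y\<in>F. n \<bullet> x \<le> n \<bullet> y))"


subsection \<open>Meshes and boundary conditions\<close>

text \<open>
  Elements are closed polytopes; simplicial triangulations are the special case in which each of
  them is a simplex.  A face lies on the boundary of the domain or is shared by exactly two elements.
\<close>

definition mesh_of :: "(real^'d) set \<Rightarrow> (real^'d) set set \<Rightarrow> bool" where
  "mesh_of \<Omega> M \<longleftrightarrow>
     finite M \<and> \<Union>M = closure \<Omega> \<and>
     (\<forall>D\<in>M. polytope D \<and> interior D \<noteq> {} \<and> interior D \<subseteq> \<Omega>) \<and>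
     (\<forall>D\<in>M. \<forall>D'\<in>M. D \<noteq> D' \<longrightarrow> interior D \<inter> interior D' = {}) \<and>
     (\<forall>D\<in>M. \<forall>F. F facet_of D \<longrightarrow>
        F \<subseteq> frontier \<Omega> \<or>
        rel_interior F \<subseteq> \<Omega> \<and> (\<exists>!D'. D' \<in> M \<and> D' \<noteq> D \<and> F facet_of D'))"

text \<open>
  \<open>Periodic D' t\<close> on a boundary face \<open>F\<close> of \<open>D\<close>: \<open>F\<close> is identified, by translation by \<open>t\<close>,
  with the boundary face \<open>F + t\<close> of \<open>D'\<close>.  \<open>Exterior B\<close>: the exterior value is \<open>B U\<close>, given by
  a homogeneous boundary condition.
\<close>

datatype ('d, 'm) face_bc =
    Periodic "(real^'d) set" "real^'d"
  | Exterior "(real^'d \<Rightarrow> real^'m) \<Rightarrow> real^'d \<Rightarrow> real^'m"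

record ('d, 'm) dg_problem =
  dg_domain :: "(real^'d) set"
  dg_mesh :: "(real^'d) set set"
  dg_coeff :: "'d \<Rightarrow> real^'m^'m"
  dg_degree :: nat
  dg_bc :: "(real^'d) set \<Rightarrow> (real^'d) set \<Rightarrow> ('d, 'm) face_bc"

text \<open>The space $V$; values on the null set outside the interiors of the elements are irrelevant.\<close>

definition dg_space :: "('d::finite, 'm::finite) dg_problem \<Rightarrow> (real^'d \<Rightarrow> real^'m) set" where
  "dg_space G =
     {U. l2_fun (lebesgue_on (dg_domain G)) U \<and>
         (\<forall>D\<in>dg_mesh G. \<exists>p. (\<forall>j. (\<lambda>x. p x $ j) \<in> poly_fun_le (dg_degree G)) \<and>
                            (\<forall>x\<in>interior D. U x = p x))}"

text \<open>
  For \<open>Exterior B\<close> the last condition is linearity of \<open>B\<close> on $V \subseteq L^2(\Omega)^m$; as equality is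
  meant almost everywhere, it includes that \<open>B U\<close> does not depend on the representative of \<open>U\<close>.
\<close>

definition bc_ok ::
  "('d::finite, 'm::finite) dg_problem \<Rightarrow> (real^'d) set \<Rightarrow> (real^'d) set \<Rightarrow> bool" where
  "bc_ok G D F \<longleftrightarrow>
     (case dg_bc G D F of
        Periodic D' t \<Rightarrow>
          D' \<in> dg_mesh G \<and> (+) t ` F facet_of D' \<and> (+) t ` F \<subseteq> frontier (dg_domain G) \<and>
          dg_bc G D' ((+) t ` F) = Periodic D (- t) \<and>
          outward_normal D' ((+) t ` F) = - outward_normal D F
      | Exterior B \<Rightarrow>
          (\<forall>U\<in>dg_space G. l2_fun (face_measure (outward_normal D F) F) (B U)) \<and>
          (\<forall>U\<in>dg_space G. \<forall>W\<in>dg_space G. \<forall>Z\<in>dg_space G. \<forall>a b.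
             (AE x in lebesgue_on (dg_domain G). Z x = a *\<^sub>R U x + b *\<^sub>R W x) \<longrightarrow>
             (AE x in face_measure (outward_normal D F) F. B Z x = a *\<^sub>R B U x + b *\<^sub>R B W x)))"

definition dg_setting :: "('d::finite, 'm::finite) dg_problem \<Rightarrow> bool" where
  "dg_setting G \<longleftrightarrow>
     open (dg_domain G) \<and> connected (dg_domain G) \<and> dg_domain G \<noteq> {} \<and> bounded (dg_domain G) \<and>
     mesh_of (dg_domain G) (dg_mesh G) \<and>
     (\<forall>i. transpose (dg_coeff G i) = dg_coeff G i) \<and>
     (\<forall>D\<in>dg_mesh G. \<forall>F. F facet_of D \<longrightarrow> F \<subseteq> frontier (dg_domain G) \<longrightarrow> bc_ok G D F)"


subsection \<open>Traces, jumps and averages\<close>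

definition trace_from :: "(real^'d) set \<Rightarrow> (real^'d \<Rightarrow> real^'m) \<Rightarrow> real^'d \<Rightarrow> real^'m" where
  "trace_from D U x = Lim (at x within interior D) U"

definition neighbour :: "('d::finite, 'm::finite) dg_problem \<Rightarrow>
    (real^'d) set \<Rightarrow> (real^'d) set \<Rightarrow> (real^'d) set" where
  "neighbour G D F = (THE D'. D' \<in> dg_mesh G \<and> D' \<noteq> D \<and> F facet_of D')"

definition exterior_trace :: "('d::finite, 'm::finite) dg_problem \<Rightarrow>
    (real^'d) set \<Rightarrow> (real^'d) set \<Rightarrow> (real^'d \<Rightarrow> real^'m) \<Rightarrow> real^'d \<Rightarrow> real^'m" where
  "exterior_trace G D F U x =
     (if F \<subseteq> frontier (dg_domain G)
      then (case dg_bc G D F of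
              Periodic D' t \<Rightarrow> trace_from D' U (t + x)
            | Exterior B \<Rightarrow> B U x)
      else trace_from (neighbour G D F) U x)"

definition jump :: "('d::finite, 'm::finite) dg_problem \<Rightarrow>
    (real^'d) set \<Rightarrow> (real^'d) set \<Rightarrow> (real^'d \<Rightarrow> real^'m) \<Rightarrow> real^'d \<Rightarrow> real^'m" where
  "jump G D F U x = exterior_trace G D F U x - trace_from D U x"

definition average :: "('d::finite, 'm::finite) dg_problem \<Rightarrow>
    (real^'d) set \<Rightarrow> (real^'d) set \<Rightarrow> (real^'d \<Rightarrow> real^'m) \<Rightarrow> real^'d \<Rightarrow> real^'m" where
  "average G D F U x = (1/2) *\<^sub>R (exterior_trace G D F U x + trace_from D U x)"

definition normal_matrix ::
  "('d::finite, 'm::finite) dg_problem \<Rightarrow> (real^'d) set \<Rightarrow> (real^'d) set \<Rightarrow> real^'m^'m" where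
  "normal_matrix G D F = (\<Sum>i\<in>UNIV. (outward_normal D F $ i) *\<^sub>R dg_coeff G i)"

definition normal_jump :: "('d::finite, 'm::finite) dg_problem \<Rightarrow>
    (real^'d) set \<Rightarrow> (real^'d) set \<Rightarrow> (real^'d \<Rightarrow> real^'m) \<Rightarrow> real^'d \<Rightarrow> real^'m" where
  "normal_jump G D F U x = normal_matrix G D F *v jump G D F U x"


subsection \<open>The bilinear form, the subspaces and the matrices\<close>

definition partial_deriv :: "'d::finite \<Rightarrow> (real^'d \<Rightarrow> real^'m) \<Rightarrow> real^'d \<Rightarrow> real^'m" where
  "partial_deriv i U x = frechet_derivative U (at x) (axis i 1)"

definition volume_form :: "('d::finite, 'm::finite) dg_problem \<Rightarrow>
    (real^'d \<Rightarrow> real^'m) \<Rightarrow> (real^'d \<Rightarrow> real^'m) \<Rightarrow> real" where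
  "volume_form G U W =
     (\<Sum>D\<in>dg_mesh G. 1/2 * (\<Sum>i\<in>UNIV.
        l2_inner (lebesgue_on D) (\<lambda>x. dg_coeff G i *v U x) (partial_deriv i W) -
        l2_inner (lebesgue_on D) (\<lambda>x. dg_coeff G i *v partial_deriv i U x) W))"

definition face_inner :: "(real^'d) set \<Rightarrow> ((real^'d) set \<Rightarrow> real^'d \<Rightarrow> real^'m) \<Rightarrow>
    ((real^'d) set \<Rightarrow> real^'d \<Rightarrow> real^'m) \<Rightarrow> real" where
  "face_inner D f g =
     (\<Sum>F | F facet_of D. l2_inner (face_measure (outward_normal D F) F) (f F) (g F))"

definition dg_form :: "('d::finite, 'm::finite) dg_problem \<Rightarrow> real \<Rightarrow>
    (real^'d \<Rightarrow> real^'m) \<Rightarrow> (real^'d \<Rightarrow> real^'m) \<Rightarrow> real" where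
  "dg_form G \<tau> U W =
     volume_form G U W
     + (\<Sum>D\<in>dg_mesh G. 1/4 *
          (face_inner D (\<lambda>F. average G D F U) (\<lambda>F. normal_jump G D F W) -
           face_inner D (\<lambda>F. normal_jump G D F U) (\<lambda>F. average G D F W)))
     - (\<Sum>D\<in>dg_mesh G. \<tau>/4 *
          face_inner D (\<lambda>F. normal_jump G D F U) (\<lambda>F. normal_jump G D F W))"

definition conforming_space ::
  "('d::finite, 'm::finite) dg_problem \<Rightarrow> (real^'d \<Rightarrow> real^'m) set" where
  "conforming_space G =
     {U \<in> dg_space G. \<forall>D\<in>dg_mesh G. \<forall>F. F facet_of D \<longrightarrow>
        (AE x in face_measure (outward_normal D F) F. normal_jump G D F U x = 0)}"

definition nonconforming_space ::
  "('d::finite, 'm::finite) dg_problem \<Rightarrow> (real^'d \<Rightarrow> real^'m) set" where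
  "nonconforming_space G =
     {U \<in> dg_space G. \<forall>W\<in>conforming_space G. l2_inner (lebesgue_on (dg_domain G)) U W = 0}"

definition combined_basis :: "nat \<Rightarrow> (nat \<Rightarrow> 'f) \<Rightarrow> (nat \<Rightarrow> 'f) \<Rightarrow> nat \<Rightarrow> 'f" where
  "combined_basis n \<Phi> \<Psi> j = (if j < n then \<Phi> j else \<Psi> (j - n))"

definition dg_matrix :: "('d::finite, 'm::finite) dg_problem \<Rightarrow>
    nat \<Rightarrow> (nat \<Rightarrow> real^'d \<Rightarrow> real^'m) \<Rightarrow> nat \<Rightarrow> (nat \<Rightarrow> real^'d \<Rightarrow> real^'m) \<Rightarrow>
    real \<Rightarrow> real Matrix.mat" where
  "dg_matrix G NC \<Phi> NNC \<Psi> \<tau> =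
     Matrix.mat (NC + NNC) (NC + NNC)
       (\<lambda>(r, s). dg_form G \<tau> (combined_basis NC \<Phi> \<Psi> s) (combined_basis NC \<Phi> \<Psi> r))"

definition conforming_matrix :: "('d::finite, 'm::finite) dg_problem \<Rightarrow>
    nat \<Rightarrow> (nat \<Rightarrow> real^'d \<Rightarrow> real^'m) \<Rightarrow> real Matrix.mat" where
  "conforming_matrix G NC \<Phi> = Matrix.mat NC NC (\<lambda>(r, s). volume_form G (\<Phi> s) (\<Phi> r))"

text \<open>The complex eigenvalues of a real square matrix, with algebraic multiplicity.\<close>

definition eigenvalue_mset :: "real Matrix.mat \<Rightarrow> complex multiset" where
  "eigenvalue_mset K = proots (char_poly (map_mat complex_of_real K))"

end

theory Submission
  imports Defs
begin

text \<open>
  In the combined basis \<open>K(\<tau>) = K(0) - \<tau> S\<close>, where \<open>K(0)\<close> is real skew-symmetric with conforming block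
  \<open>A\<close>, and \<open>S\<close> vanishes outside the nonconforming block, where it is positive definite: a
  nonconforming function without normal jumps would also be conforming, hence zero.

  Counting: the polynomial \<open>\<tau> ^ (- NNC) * det (x - K(\<tau>))\<close> converges coefficientwise to
  \<open>det S * det (x - A)\<close>, so \<open>NC\<close> of the eigenvalues converge to those of \<open>A\<close> with multiplicity and
  the others leave every bounded set.

  Rates: if \<open>(u, v)\<close> is an eigenvector for \<open>\<lambda>\<close>, the real part of the second block row paired with \<open>v\<close>
  gives \<open>Re \<lambda> < - \<tau> s / 2\<close> or \<open>|v| = O(|u| / \<tau>)\<close>.  In the second case the first block row reads
  \<open>(A - \<lambda>) u = O(|u| / \<tau>)\<close>, and since \<open>A\<close> is skew, some eigenvalue of \<open>A\<close> is within \<open>O(1 / \<tau>)\<close>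
  of \<open>\<lambda>\<close>.
\<close>

subsection \<open>Roots of convergent polynomials\<close>

text \<open>Neither half of the argument suffices alone. Convergence of the scaled characteristic
  polynomials gives no rate 1/\<tau> at a multiple eigenvalue of \<open>A\<close>, since a root of
  multiplicity k generally moves like the k-th root of the perturbation. Moreover,
  \<open>K(\<tau>)\<close> need not be normal, so stability of normal spectra cannot be applied to
  it directly. Normality of the skew block \<open>A\<close> repairs the rate: an approximate unit
  eigenvector with residual r puts an eigenvalue of \<open>A\<close> within r, whatever its
  multiplicity. But that eigenvalue may change with \<tau>, and nothing is counted. As
  \<open>A\<close> has finitely many eigenvalues, a convergent enumeration eventually has only its
  own limit within reach, and this joins the two halves.

  The threshold \<open>- \<tau> * s / 2\<close> splits the damping \<open>\<tau> * s\<close> in two: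
  one half absorbs the real part of the eigenvalue, the other controls the nonconforming part of the
  eigenvector.

  Skewness concerns single matrix entries. Linearity matters only for the penalty, whose
  definiteness is about combinations of basis functions, and there linearity almost everywhere is
  enough.\<close>

lemma poly_altdef_le:
  fixes r :: "'a::comm_semiring_1 poly"
  assumes "degree r \<le> n"
  shows "poly r x = (\<Sum>i\<le>n. coeff r i * x ^ i)"
  unfolding poly_altdef using assms
  by (intro sum.mono_neutral_left) (auto simp: coeff_eq_0)

text \<open>The common degree bound turns evaluation into one fixed finite sum; convergence of each
  coefficient separately would not control the values otherwise.\<close>

lemma tendsto_poly_of_coeffs:
  fixes p :: "'b \<Rightarrow> 'a::{comm_semiring_1, real_normed_algebra} poly"
  assumes deg: "\<forall>\<^sub>F t in F. degree (p t) \<le> n" and "degree q \<le> n"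
    and lim: "\<And>k. ((\<lambda>t. coeff (p t) k) \<longlongrightarrow> coeff q k) F"
  shows "((\<lambda>t. poly (p t) x) \<longlongrightarrow> poly q x) F"
proof -
  have "((\<lambda>t. \<Sum>i\<le>n. coeff (p t) i * x ^ i) \<longlongrightarrow> (\<Sum>i\<le>n. coeff q i * x ^ i)) F"
    by (intro tendsto_intros lim)
  moreover have "\<forall>\<^sub>F t in F. (\<Sum>i\<le>n. coeff (p t) i * x ^ i) = poly (p t) x"
    using deg by eventually_elim (simp add: poly_altdef_le)
  ultimately show ?thesis
    using poly_altdef_le[OF \<open>degree q \<le> n\<close>] by (simp add: tendsto_cong)
qed

text \<open>If no root lies in the ball, then every root is at most twice as far from \<open>w\<close> as from
  the centre.\<close>

lemma norm_poly_le_of_no_root_in_ball: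
  fixes p :: "complex poly"
  assumes "\<And>x. poly p x = 0 \<Longrightarrow> \<delta> \<le> dist x a" and "dist w a \<le> \<delta>"
  shows "norm (poly p w) \<le> 2 ^ degree p * norm (poly p a)"
proof (cases "p = 0")
  case False
  have p: "p = Polynomial.smult (lead_coeff p) (\<Prod>x\<in>#proots p. [:- x, 1:])"
    using complex_poly_decompose_multiset[of p] by simp
  have "norm (\<Prod>x\<in>#M. y - x) = (\<Prod>x\<in>#M. norm (y - x))" for M and y :: complex
    by (induction M) (auto simp: norm_mult)
  then have *: "norm (poly p y) = norm (lead_coeff p) * (\<Prod>x\<in>#proots p. norm (y - x))" for y
    by (subst p) (simp add: poly_prod_mset norm_mult image_mset.compositionality o_def)
  \<comment> \<open>Nonnegativity is carried through the induction because multiplying the two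
    inequalities requires it.\<close>
  have "0 \<le> (\<Prod>x\<in>#M. norm (w - x)) \<and>
      (\<Prod>x\<in>#M. norm (w - x)) \<le> 2 ^ size M * (\<Prod>x\<in>#M. norm (a - x))"
    if "\<And>x. x \<in># M \<Longrightarrow> norm (w - x) \<le> 2 * norm (a - x)" for M :: "complex multiset"
    using that
  proof (induction M)
    case (add x M)
    have "norm (w - x) * (\<Prod>x\<in>#M. norm (w - x))
        \<le> (2 * norm (a - x)) * (2 ^ size M * (\<Prod>x\<in>#M. norm (a - x)))"
      using add by (intro mult_mono) auto
    then show ?case using add by (simp add: mult_ac)
  qed simp
  moreover have "norm (w - x) \<le> 2 * norm (a - x)" if "x \<in># proots p" for x
  proof -
    have "\<delta> \<le> dist x a" using that assms(1) False by simp
    moreover have "dist w x \<le> dist w a + dist a x" by (rule dist_triangle)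
    ultimately show ?thesis using assms(2) by (simp add: dist_norm norm_minus_commute)
  qed
  ultimately have "(\<Prod>x\<in>#proots p. norm (w - x)) \<le> 2 ^ size (proots p) * (\<Prod>x\<in>#proots p. norm (a - x))"
    by blast
  then show ?thesis
    unfolding * size_proots_complex by (simp add: mult_left_mono mult.left_commute)
qed simp

text \<open>Pick \<open>w\<close> in the ball with \<open>q\<close> nonzero at \<open>w\<close>.
  Without a root near \<open>a\<close>, the value of \<open>p t\<close> at \<open>w\<close> would be
  at most \<open>2 ^ n\<close> times its value at \<open>a\<close>, but the former tends to a
  nonzero limit and the latter to 0. The strict inequality also excludes the zero
  polynomial.\<close>

lemma eventually_root_near:
  fixes p :: "'b \<Rightarrow> complex poly"
  assumes deg: "\<forall>\<^sub>F t in F. degree (p t) \<le> n" "degree q \<le> n"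
    and lim: "\<And>k. ((\<lambda>t. coeff (p t) k) \<longlongrightarrow> coeff q k) F"
    and "q \<noteq> 0" "poly q a = 0" "\<delta> > 0"
  shows "\<forall>\<^sub>F t in F. p t \<noteq> 0 \<and> (\<exists>x. poly (p t) x = 0 \<and> dist x a < \<delta>)"
proof -
  have "infinite (ball a \<delta>)"
    using \<open>\<delta> > 0\<close> using uncountable_ball countable_finite by blast
  moreover have "finite {x. poly q x = 0}"
    using \<open>q \<noteq> 0\<close> by (rule poly_roots_finite)
  ultimately obtain w where w: "w \<in> ball a \<delta>" "poly q w \<noteq> 0"
    by (metis (mono_tags, lifting) finite_subset mem_Collect_eq subsetI)
  have "((\<lambda>t. 2 ^ n * norm (poly (p t) a) - norm (poly (p t) w)) \<longlongrightarrow>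
      2 ^ n * norm (poly q a) - norm (poly q w)) F"
    by (intro tendsto_intros tendsto_poly_of_coeffs[OF deg lim])
  then have "\<forall>\<^sub>F t in F. 2 ^ n * norm (poly (p t) a) - norm (poly (p t) w) < 0"
    by (rule order_tendstoD) (use w \<open>poly q a = 0\<close> in simp)
  with deg(1) show ?thesis
  proof eventually_elim
    case (elim t)
    have "2 ^ degree (p t) * norm (poly (p t) a) \<le> 2 ^ n * norm (poly (p t) a)"
      using elim(1) by (intro mult_right_mono power_increasing) auto
    then have "\<not> norm (poly (p t) w) \<le> 2 ^ degree (p t) * norm (poly (p t) a)"
      using elim(2) by linarith
    moreover have "dist w a \<le> \<delta>" using w(1) by (simp add: dist_commute)
    ultimately show ?case
      using norm_poly_le_of_no_root_in_ball[of "p t" \<delta> a w] by (force simp: not_le)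
  qed
qed

text \<open>The degree may drop in the limit; the missing roots escape to infinity.\<close>

theorem proots_tendsto:
  fixes p :: "'b \<Rightarrow> complex poly" and m :: nat
  assumes "\<forall>\<^sub>F t in F. degree (p t) \<le> n" "degree q \<le> n"
    and "\<And>k. ((\<lambda>t. coeff (p t) k) \<longlongrightarrow> coeff q k) F"
    and "q \<noteq> 0" "proots q = image_mset \<mu> (mset_set {..<m})"
  shows "\<exists>f. (\<forall>j<m. ((\<lambda>t. f t j) \<longlongrightarrow> \<mu> j) F) \<and>
    (\<forall>\<^sub>F t in F. image_mset (f t) (mset_set {..<m}) \<subseteq># proots (p t)) \<and>
    (\<forall>R. \<forall>\<^sub>F t in F. \<forall>x\<in>#proots (p t) - image_mset (f t) (mset_set {..<m}). R < cmod x)"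
  using assms
proof (induction m arbitrary: p q)
  case 0
  have "degree q = 0"
    using 0 by (simp flip: size_proots_complex)
  then obtain c where q: "q = [:c:]" "c \<noteq> 0"
    using \<open>q \<noteq> 0\<close> by (metis degree_eq_zeroE pCons_0_0)
  have "\<forall>\<^sub>F t in F. \<forall>x\<in>#proots (p t). R < cmod x" for R
  proof -
    \<comment> \<open>At a root of \<open>p t\<close>, the difference \<open>p t - q\<close> has the
      fixed size \<open>norm c\<close>, whereas on the disc of radius \<open>\<bar>R\<bar>\<close>
      it is bounded by this sum, which tends to 0.\<close>
    have "((\<lambda>t. \<Sum>i\<le>n. norm (coeff (p t) i - coeff q i) * \<bar>R\<bar> ^ i) \<longlongrightarrow>
        (\<Sum>i\<le>n. norm (coeff q i - coeff q i) * \<bar>R\<bar> ^ i)) F"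
      by (intro tendsto_intros 0)
    then have "\<forall>\<^sub>F t in F. (\<Sum>i\<le>n. norm (coeff (p t) i - coeff q i) * \<bar>R\<bar> ^ i) < norm c"
      by (rule order_tendstoD) (use q in simp)
    with 0(1) show ?thesis
    proof eventually_elim
      case (elim t)
      have "R < cmod x" if "x \<in># proots (p t)" for x
      proof (rule ccontr)
        assume "\<not> R < cmod x"
        then have R: "cmod x \<le> \<bar>R\<bar>" by simp
        have "poly (p t) x = 0"
          using that by (cases "p t = 0") auto
        moreover have "poly (p t - q) x = (\<Sum>i\<le>n. coeff (p t - q) i * x ^ i)"
          using elim(1) 0(2) by (intro poly_altdef_le degree_diff_le)
        ultimately have "norm c = norm (\<Sum>i\<le>n. (coeff (p t) i - coeff q i) * x ^ i)"
          using q by (simp flip: norm_minus_cancel[of c])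
        also have "\<dots> \<le> (\<Sum>i\<le>n. norm (coeff (p t) i - coeff q i) * \<bar>R\<bar> ^ i)"
          by (intro sum_norm_le) (auto simp: norm_mult norm_power intro!: mult_left_mono power_mono R)
        finally show False using elim(2) by simp
      qed
      then show ?case by blast
    qed
  qed
  then show ?case by simp
next
  case (Suc m)
  define a where "a = \<mu> m"
  have "a \<in># proots q"
    using Suc.prems by (simp add: a_def)
  then have qa: "poly q a = 0"
    using \<open>q \<noteq> 0\<close> by simp
  define r where "r = synthetic_div q a"
  have q: "q = [:- a, 1:] * r"
    using synthetic_div_correct'[of a q] qa by (simp add: r_def degree_synthetic_div)
  have "\<forall>\<^sub>F t in F. p t \<noteq> 0 \<and> (\<exists>x. poly (p t) x = 0 \<and> dist x a < \<delta>)" if "\<delta> > 0" for \<delta>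
    using eventually_root_near[OF Suc.prems(1,2,3,4) qa that] .
  note near = this
  \<comment> \<open>Taking the root nearest to \<open>a\<close> yields a single function of
    \<open>t\<close> that serves all radii at once.\<close>
  define l where "l t = arg_min_on (\<lambda>x. dist x a) {x. poly (p t) x = 0}" for t
  have l: "poly (p t) (l t) = 0" "\<And>x. poly (p t) x = 0 \<Longrightarrow> dist (l t) a \<le> dist x a"
    if "p t \<noteq> 0" "poly (p t) x = 0" for t x
  proof -
    have *: "finite {x. poly (p t) x = 0}" "{x. poly (p t) x = 0} \<noteq> {}"
      using that poly_roots_finite by auto
    show "poly (p t) (l t) = 0"
      using arg_min_if_finite(1)[OF *] by (auto simp: l_def)
    show "dist (l t) a \<le> dist x a" if "poly (p t) x = 0" for x
      unfolding l_def using arg_min_least[OF *] that by auto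
  qed
  have ev: "\<forall>\<^sub>F t in F. p t \<noteq> 0 \<and> poly (p t) (l t) = 0"
    by (rule eventually_mono[OF near[of 1]]) (use l(1) in auto)
  have liml: "(l \<longlongrightarrow> a) F"
  proof (rule tendstoI)
    fix e :: real assume "e > 0"
    from near[OF this] show "\<forall>\<^sub>F t in F. dist (l t) a < e"
      by eventually_elim (use l(2) in force)
  qed
  define s where "s t = synthetic_div (p t) (l t)" for t
  have p: "\<forall>\<^sub>F t in F. p t = [:- l t, 1:] * s t"
    using ev
  proof eventually_elim
    case (elim t)
    then show ?case using synthetic_div_correct'[of "l t" "p t"] by (simp add: s_def degree_synthetic_div)
  qed
  have degs: "\<forall>\<^sub>F t in F. degree (s t) \<le> n"
    using Suc.prems(1) by eventually_elim (simp add: s_def degree_synthetic_div)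
  have degr: "degree r \<le> n"
    using Suc.prems(2) by (simp add: r_def degree_synthetic_div)
  \<comment> \<open>Downward induction along synthetic division: each quotient coefficient is
    obtained from the next higher one, and those at \<open>Suc n\<close> vanish by the degree
    bound.\<close>
  have lims: "((\<lambda>t. coeff (s t) k) \<longlongrightarrow> coeff r k) F" if "k \<le> Suc n" for k
    using that
  proof (induction k rule: inc_induct)
    case base
    have "\<forall>\<^sub>F t in F. coeff (s t) (Suc n) = 0"
      using degs by eventually_elim (simp add: coeff_eq_0)
    then show ?case using degr by (simp add: coeff_eq_0 tendsto_eventually)
  next
    case (step k)
    have r: "coeff r k = coeff q (Suc k) + a * coeff r (Suc k)"
      by (subst q) simp
    have "\<forall>\<^sub>F t in F. coeff (s t) k = coeff (p t) (Suc k) + l t * coeff (s t) (Suc k)"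
      using p by eventually_elim (simp add: coeff_pCons split: nat.splits)
    moreover have "((\<lambda>t. coeff (p t) (Suc k) + l t * coeff (s t) (Suc k)) \<longlongrightarrow> coeff r k) F"
      unfolding r by (intro tendsto_intros liml step Suc.prems)
    ultimately show ?case by (simp add: tendsto_cong)
  qed
  have lims': "((\<lambda>t. coeff (s t) k) \<longlongrightarrow> coeff r k) F" for k
  proof (cases "k \<le> Suc n")
    case False
    have "\<forall>\<^sub>F t in F. coeff (s t) k = 0"
      using degs by eventually_elim (use False in \<open>simp add: coeff_eq_0\<close>)
    then show ?thesis using degr False by (simp add: coeff_eq_0 tendsto_eventually)
  qed (use lims in blast)
  have "r \<noteq> 0" using q \<open>q \<noteq> 0\<close> by auto
  have "proots q = {#a#} + proots r"
    using \<open>r \<noteq> 0\<close> by (subst q, subst proots_mult) auto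
  then have "proots r = image_mset \<mu> (mset_set {..<m})"
    using Suc.prems(5) by (simp add: lessThan_Suc a_def)
  from Suc.IH[OF degs degr lims' \<open>r \<noteq> 0\<close> this] obtain f
    where f: "\<And>j. j < m \<Longrightarrow> ((\<lambda>t. f t j) \<longlongrightarrow> \<mu> j) F"
      "\<forall>\<^sub>F t in F. image_mset (f t) (mset_set {..<m}) \<subseteq># proots (s t)"
      "\<And>R. \<forall>\<^sub>F t in F. \<forall>x\<in>#proots (s t) - image_mset (f t) (mset_set {..<m}). R < cmod x"
    by blast
  define g where "g t = (f t)(m := l t)" for t
  have img: "image_mset (g t) (mset_set {..<Suc m}) = add_mset (l t) (image_mset (f t) (mset_set {..<m}))" for t
  proof -
    have "image_mset (g t) (mset_set {..<m}) = image_mset (f t) (mset_set {..<m})"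
      by (rule image_mset_cong) (auto simp: g_def)
    then show ?thesis by (simp add: lessThan_Suc g_def)
  qed
  have roots: "\<forall>\<^sub>F t in F. proots (p t) = add_mset (l t) (proots (s t))"
    using p ev
  proof eventually_elim
    case (elim t)
    then have "s t \<noteq> 0" by auto
    then have "proots (p t) = proots [:- l t, 1:] + proots (s t)"
      by (subst elim(1), subst proots_mult) auto
    then show ?case by simp
  qed
  show ?case
  proof (intro exI[of _ g] conjI allI impI)
    show "((\<lambda>t. g t j) \<longlongrightarrow> \<mu> j) F" if "j < Suc m" for j
      using f(1)[of j] liml that by (cases "j = m") (auto simp: g_def a_def)
    show "\<forall>\<^sub>F t in F. image_mset (g t) (mset_set {..<Suc m}) \<subseteq># proots (p t)"
      using f(2) roots by eventually_elim (simp add: img del: mset_set.insert)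
    show "\<forall>\<^sub>F t in F. \<forall>x\<in>#proots (p t) - image_mset (g t) (mset_set {..<Suc m}). R < cmod x" for R
      using f(3)[of R] roots by eventually_elim (simp add: img)
  qed
qed

subsection \<open>Skew-Hermitian matrices with a dissipative block\<close>

text \<open>Vectors are functions on a whole index type, so the sphere given by the coordinates in
  \<open>I\<close> is compact only after the remaining coordinates are pinned to 0;
  \<open>loc\<close> allows this without changing \<open>f\<close>. Compactness then comes from the
  product topology, and homogeneity carries the bound from the sphere to all vectors.\<close>

lemma attains_inf_on_sphere:
  fixes f :: "('i \<Rightarrow> 'a::euclidean_space) \<Rightarrow> real"
  assumes "finite I" "continuous_on UNIV f"
    and hom: "\<And>c u. f (\<lambda>i. c *\<^sub>R u i) = c\<^sup>2 * f u"
    and loc: "\<And>u v. (\<And>i. i \<in> I \<Longrightarrow> u i = v i) \<Longrightarrow> f u = f v"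
    and "I \<noteq> {}"
  shows "\<exists>v. (\<Sum>i\<in>I. (norm (v i))\<^sup>2) = 1 \<and> (\<forall>u. f v * (\<Sum>i\<in>I. (norm (u i))\<^sup>2) \<le> f u)"
proof -
  define B where "B = (\<Pi>\<^sub>E i\<in>UNIV. if i \<in> I then cball (0::'a) 1 else {0})"
  define S where "S = B \<inter> {u. (\<Sum>i\<in>I. (norm (u i))\<^sup>2) = 1}"
  have "compactin (product_topology (\<lambda>i. euclidean) UNIV) B"
    unfolding B_def by (subst compactin_PiE) auto
  then have "compact B" by (simp add: euclidean_product_topology)
  moreover have "closed {u :: 'i \<Rightarrow> 'a. (\<Sum>i\<in>I. (norm (u i))\<^sup>2) = 1}"
    by (intro closed_Collect_eq continuous_intros continuous_on_product_coordinates)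
  ultimately have "compact S" unfolding S_def by (rule compact_Int_closed)
  have *: "(\<lambda>i. if i \<in> I then u i else 0) \<in> S" if "(\<Sum>i\<in>I. (norm (u i))\<^sup>2) = 1" for u :: "'i \<Rightarrow> 'a"
  proof -
    have "norm (u i) \<le> 1" if "i \<in> I" for i
    proof -
      have "(norm (u i))\<^sup>2 \<le> (\<Sum>i\<in>I. (norm (u i))\<^sup>2)"
        using \<open>finite I\<close> that by (intro member_le_sum) auto
      then show ?thesis using \<open>(\<Sum>i\<in>I. (norm (u i))\<^sup>2) = 1\<close> by (simp add: power_le_one_iff)
    qed
    then show ?thesis using that by (simp add: S_def B_def PiE_iff)
  qed
  obtain i0 where i0: "i0 \<in> I" using \<open>I \<noteq> {}\<close> by blast
  obtain b :: 'a where b: "b \<in> Basis" using nonempty_Basis by blast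
  have "(\<Sum>i\<in>I. (norm (if i = i0 then b else 0))\<^sup>2) = 1"
  proof -
    have "(\<Sum>i\<in>I. (norm (if i = i0 then b else 0))\<^sup>2) = (\<Sum>i\<in>I. if i = i0 then 1 else 0)"
      using b by (intro sum.cong) auto
    then show ?thesis using i0 \<open>finite I\<close> by simp
  qed
  then have "S \<noteq> {}" using *[of "\<lambda>i. if i = i0 then b else 0"] by blast
  then obtain v where v: "v \<in> S" "\<And>u. u \<in> S \<Longrightarrow> f v \<le> f u"
    using continuous_attains_inf[OF \<open>compact S\<close>, of f] continuous_on_subset[OF assms(2)] by blast
  have "f v * (\<Sum>i\<in>I. (norm (u i))\<^sup>2) \<le> f u" for u
  proof (cases "(\<Sum>i\<in>I. (norm (u i))\<^sup>2) = 0")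
    case True
    then have "u i = 0" if "i \<in> I" for i
      using that \<open>finite I\<close> by (simp add: sum_nonneg_eq_0_iff)
    then have "f u = f (\<lambda>i. 0 *\<^sub>R u i)" by (intro loc) simp
    then show ?thesis using True hom[of 0 u] by simp
  next
    case False
    define r where "r = (\<Sum>i\<in>I. (norm (u i))\<^sup>2)"
    have r: "r > 0" using False by (simp add: r_def less_le sum_nonneg)
    define w where "w i = (1 / sqrt r) *\<^sub>R u i" for i
    have "(\<Sum>i\<in>I. (norm (w i))\<^sup>2) = 1"
      using r by (simp add: w_def power_divide flip: sum_divide_distrib r_def)
    then have "f v \<le> f (\<lambda>i. if i \<in> I then w i else 0)"
      by (intro v *)
    also have "\<dots> = f w" by (intro loc) simp
    also have "\<dots> = f u / r"
      using r hom[of "1 / sqrt r" u] by (simp add: w_def[abs_def] power_divide)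
    finally show ?thesis using r by (simp add: field_simps flip: r_def)
  qed
  then show ?thesis using v(1) by (auto simp: S_def)
qed

text \<open>The first-order condition at a minimum, in a form that avoids differentiation.\<close>

lemma quadratic_nonneg_imp_linear_zero:
  fixes a b :: real
  assumes "\<And>t. 0 \<le> 2 * t * a + t\<^sup>2 * b"
  shows "a = 0"
proof (rule ccontr)
  assume "a \<noteq> 0"
  define c where "c = \<bar>b\<bar> + 1"
  have c: "c > 0" "b < c" by (auto simp: c_def)
  \<comment> \<open>Moving against the linear term by \<open>a / c\<close> gains
    \<open>2 * a^2 / c\<close>, while the quadratic term costs less than \<open>a^2 / c\<close>
    because \<open>b < c\<close>.\<close>
  have "0 \<le> 2 * (- a / c) * a + (- a / c)\<^sup>2 * b" by (rule assms)
  also have "\<dots> = (a\<^sup>2 / c\<^sup>2) * (b - 2 * c)"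
    using c by (simp add: field_simps power2_eq_square)
  also have "\<dots> < 0"
    using c \<open>a \<noteq> 0\<close> by (intro mult_pos_neg) auto
  finally show False by simp
qed

section \<open>Hermitian pairing and skew matrices over finite index sets\<close>

definition cip :: "'i set \<Rightarrow> ('i \<Rightarrow> complex) \<Rightarrow> ('i \<Rightarrow> complex) \<Rightarrow> complex" where
  "cip I u v = (\<Sum>i\<in>I. u i * cnj (v i))"

text \<open>\<open>I\<close> restricts only the columns and the row index stays free, so the
  diagonal and off-diagonal blocks of one matrix are all reached by choosing the two ranges
  separately.\<close>

definition mvec :: "'i set \<Rightarrow> ('i \<Rightarrow> 'i \<Rightarrow> complex) \<Rightarrow> ('i \<Rightarrow> complex) \<Rightarrow> 'i \<Rightarrow> complex" where
  "mvec I A u i = (\<Sum>j\<in>I. A i j * u j)"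

lemma cip_add_left: "cip I (\<lambda>i. u i + v i) w = cip I u w + cip I v w"
  and cip_diff_left: "cip I (\<lambda>i. u i - v i) w = cip I u w - cip I v w"
  and cip_scale_left: "cip I (\<lambda>i. c * u i) w = c * cip I u w"
  and cip_add_right: "cip I w (\<lambda>i. u i + v i) = cip I w u + cip I w v"
  and cip_scale_right: "cip I w (\<lambda>i. c * u i) = cnj c * cip I w u"
  by (simp_all add: cip_def algebra_simps sum.distrib sum_subtractf sum_distrib_left)

lemma cip_self: "cip I u u = complex_of_real (\<Sum>i\<in>I. (cmod (u i))\<^sup>2)"
  by (simp only: cip_def complex_norm_square of_real_sum)

lemma cnj_cip: "cnj (cip I u v) = cip I v u"
  by (simp add: cip_def mult.commute)

lemma mvec_add: "mvec I A (\<lambda>i. u i + v i) = (\<lambda>i. mvec I A u i + mvec I A v i)"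
  and mvec_scale: "mvec I A (\<lambda>i. c * u i) = (\<lambda>i. c * mvec I A u i)"
  by (auto simp: mvec_def algebra_simps sum.distrib sum_distrib_left)

lemma mvec_cong: "(\<And>i. i \<in> I \<Longrightarrow> u i = v i) \<Longrightarrow> mvec I A u = mvec I A v"
  by (auto simp: mvec_def intro!: sum.cong)

lemma cip_cong: "(\<And>i. i \<in> I \<Longrightarrow> u i = u' i) \<Longrightarrow> (\<And>i. i \<in> I \<Longrightarrow> v i = v' i) \<Longrightarrow> cip I u v = cip I u' v'"
  by (simp add: cip_def)

lemma cip_mvec_skew:
  assumes "\<forall>i\<in>I. \<forall>j\<in>I. A i j = - cnj (A j i)"
  shows "cip I (mvec I A u) v = - cip I u (mvec I A v)"
proof -
  have "cip I (mvec I A u) v = (\<Sum>i\<in>I. \<Sum>j\<in>I. A i j * u j * cnj (v i))"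
    by (simp add: cip_def mvec_def sum_distrib_right)
  also have "\<dots> = (\<Sum>i\<in>I. \<Sum>j\<in>I. - (u j * (cnj (A j i) * cnj (v i))))"
  proof (intro sum.cong refl)
    fix i j assume "i \<in> I" "j \<in> I"
    then have "A i j = - cnj (A j i)" using assms by blast
    then show "A i j * u j * cnj (v i) = - (u j * (cnj (A j i) * cnj (v i)))" by simp
  qed
  also have "\<dots> = (\<Sum>j\<in>I. \<Sum>i\<in>I. - (u j * (cnj (A j i) * cnj (v i))))"
    by (rule sum.swap)
  also have "\<dots> = - cip I u (mvec I A v)"
    by (simp add: cip_def mvec_def sum_distrib_left sum_negf)
  finally show ?thesis .
qed

text \<open>The minimum \<open>s\<close> of \<open>|A u|\<^sup>2\<close> on the unit sphere is an eigenvalue of \<open>- A\<^sup>2\<close>, and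
  \<open>- A\<^sup>2 - s = - (A - i \<surd>s) (A + i \<surd>s)\<close>.\<close>

lemma skew_hermitian_smallest_eigenvalue:
  fixes A :: "'i \<Rightarrow> 'i \<Rightarrow> complex"
  assumes "finite I" "I \<noteq> {}"
    and skew: "\<forall>i\<in>I. \<forall>j\<in>I. A i j = - cnj (A j i)"
  shows "\<exists>z w. (\<exists>i\<in>I. w i \<noteq> 0) \<and> (\<forall>i\<in>I. mvec I A w i = z * w i) \<and> Re z = 0 \<and>
    (\<forall>u. (cmod z)\<^sup>2 * (\<Sum>i\<in>I. (cmod (u i))\<^sup>2) \<le> (\<Sum>i\<in>I. (cmod (mvec I A u i))\<^sup>2))"
proof -
  define N where "N u = (\<Sum>i\<in>I. (cmod (u i))\<^sup>2)" for u
  define f where "f u = N (mvec I A u)" for u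
  have cip_N: "cip I u u = complex_of_real (N u)" for u
    by (simp add: cip_self N_def)
  have "continuous_on UNIV f"
    unfolding f_def N_def mvec_def by (intro continuous_intros continuous_on_product_coordinates)
  moreover have "f (\<lambda>i. c *\<^sub>R u i) = c\<^sup>2 * f u" for c u
    by (simp add: f_def N_def scaleR_conv_of_real mvec_scale norm_mult power_mult_distrib sum_distrib_left)
  moreover have "f u = f v" if "\<And>i. i \<in> I \<Longrightarrow> u i = v i" for u v
    unfolding f_def by (subst mvec_cong[of I u v]) (use that in auto)
  ultimately obtain v where v: "N v = 1" "\<And>u. f v * N u \<le> f u"
    using attains_inf_on_sphere[of I f] assms(1,2) unfolding N_def by blast
  define \<sigma> where "\<sigma> = sqrt (f v)"
  have \<sigma>: "\<sigma> \<ge> 0" "\<sigma>\<^sup>2 = f v"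
    by (auto simp: \<sigma>_def f_def N_def sum_nonneg)
  have N_add: "N (\<lambda>i. x i + of_real t * y i) = N x + 2 * t * Re (cip I x y) + t\<^sup>2 * N y" for x y t
  proof -
    have "cip I (\<lambda>i. x i + of_real t * y i) (\<lambda>i. x i + of_real t * y i) =
      cip I x x + of_real t * (cip I x y + cnj (cip I x y)) + of_real (t\<^sup>2) * cip I y y"
      unfolding cip_add_left cip_add_right cip_scale_left cip_scale_right cnj_cip
      by (simp add: algebra_simps power2_eq_square)
    then have "complex_of_real (N (\<lambda>i. x i + of_real t * y i)) =
       of_real (N x + 2 * t * Re (cip I x y) + t\<^sup>2 * N y)"
      unfolding cip_N complex_add_cnj by simp
    then show ?thesis by (simp only: of_real_eq_iff)
  qed
  \<comment> \<open>The difference \<open>f - \<sigma>^2 * N\<close> is nonnegative and vanishes at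
    \<open>v\<close>, so its linear term in every direction \<open>w\<close> is zero. With a real
    parameter \<open>t\<close> only real parts appear.\<close>
  have stat: "Re (cip I (mvec I A v) (mvec I A w)) - \<sigma>\<^sup>2 * Re (cip I v w) = 0" for w
  proof (rule quadratic_nonneg_imp_linear_zero)
    fix t :: real
    have "\<sigma>\<^sup>2 * N (\<lambda>i. v i + of_real t * w i) \<le> f (\<lambda>i. v i + of_real t * w i)"
      using v(2) \<sigma> by simp
    moreover have "f v = \<sigma>\<^sup>2 * N v" using v(1) \<sigma> by simp
    ultimately show "0 \<le> 2 * t * (Re (cip I (mvec I A v) (mvec I A w)) - \<sigma>\<^sup>2 * Re (cip I v w))
        + t\<^sup>2 * (f w - \<sigma>\<^sup>2 * N w)"
      unfolding f_def mvec_add mvec_scale N_add by (simp add: algebra_simps)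
  qed
  \<comment> \<open>By skewness the stationarity condition says that the residual \<open>g\<close>
    is orthogonal, in real part, to every vector; testing with \<open>g\<close> itself makes it
    vanish.\<close>
  define g where "g i = mvec I A (mvec I A v) i + of_real (\<sigma>\<^sup>2) * v i" for i
  have "Re (cip I g w) = 0" for w
    using stat[of w]
    by (simp add: g_def[abs_def] cip_add_left cip_scale_left cip_mvec_skew[OF skew])
  then have "N g = 0" using cip_N[of g] by (metis Re_complex_of_real)
  then have g0: "mvec I A (mvec I A v) i = - of_real (\<sigma>\<^sup>2) * v i" if "i \<in> I" for i
    using that \<open>finite I\<close> unfolding N_def g_def
    by (simp add: sum_nonneg_eq_0_iff eq_neg_iff_add_eq_0)
  \<comment> \<open>As \<open>A^2 v = - \<sigma>^2 v\<close>, this vector is an eigenvector for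
    \<open>\<i> * \<sigma>\<close> unless it is zero, in which case \<open>v\<close> itself is one
    for \<open>- \<i> * \<sigma>\<close>.\<close>
  define w where "w i = mvec I A v i + \<i> * of_real \<sigma> * v i" for i
  have "\<exists>z w. (\<exists>i\<in>I. w i \<noteq> 0) \<and> (\<forall>i\<in>I. mvec I A w i = z * w i) \<and> Re z = 0 \<and> cmod z = \<sigma>"
  proof (cases "\<exists>i\<in>I. w i \<noteq> 0")
    case True
    have "\<forall>i\<in>I. mvec I A w i = \<i> * of_real \<sigma> * w i"
      unfolding w_def[abs_def] mvec_add mvec_scale
      using g0 by (simp add: algebra_simps power2_eq_square)
    moreover have "Re (\<i> * of_real \<sigma>) = 0 \<and> cmod (\<i> * of_real \<sigma>) = \<sigma>"
      using \<sigma>(1) by (simp add: norm_mult)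
    ultimately show ?thesis using True by blast
  next
    case False
    then have "\<forall>i\<in>I. mvec I A v i = - \<i> * of_real \<sigma> * v i"
      by (simp add: w_def eq_neg_iff_add_eq_0)
    moreover have "\<exists>i\<in>I. v i \<noteq> 0"
    proof (rule ccontr)
      assume "\<not> (\<exists>i\<in>I. v i \<noteq> 0)"
      then have "N v = 0" by (simp add: N_def)
      then show False using v(1) by simp
    qed
    moreover have "Re (- \<i> * of_real \<sigma>) = 0 \<and> cmod (- \<i> * of_real \<sigma>) = \<sigma>"
      using \<sigma>(1) by (simp add: norm_mult)
    ultimately show ?thesis by blast
  qed
  then obtain z w where zw: "\<exists>i\<in>I. w i \<noteq> 0" "\<forall>i\<in>I. mvec I A w i = z * w i" "Re z = 0" "cmod z = \<sigma>"
    by blast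
  have "(cmod z)\<^sup>2 * N u \<le> f u" for u
    using v(2)[of u] \<sigma> zw(4) by simp
  then have "\<forall>u. (cmod z)\<^sup>2 * (\<Sum>i\<in>I. (cmod (u i))\<^sup>2) \<le> (\<Sum>i\<in>I. (cmod (mvec I A u i))\<^sup>2)"
    unfolding f_def N_def by (rule allI)
  with zw(1-3) show ?thesis by (intro exI[of _ z] exI[of _ w] conjI)
qed

text \<open>This is the resolvent bound of a normal matrix, with \<open>z\<close> independent of
  \<open>u\<close>. Subtracting \<open>\<i> * Im l\<close> keeps the matrix skew, and for the skew
  matrix \<open>B\<close> so obtained the cross term in the square of \<open>B u - Re l * u\<close>
  is the real part of \<open>(B u, u)\<close>, which is zero. Both sides therefore gain the same
  contribution \<open>(Re l)^2\<close>, and the bound for the eigenvalue of smallest modulus of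
  \<open>B\<close> suffices.\<close>

lemma skew_hermitian_eigenvalue_near:
  fixes A :: "'i \<Rightarrow> 'i \<Rightarrow> complex"
  assumes "finite I" "I \<noteq> {}"
    and skew: "\<forall>i\<in>I. \<forall>j\<in>I. A i j = - cnj (A j i)"
  shows "\<exists>z w. (\<exists>i\<in>I. w i \<noteq> 0) \<and> (\<forall>i\<in>I. mvec I A w i = z * w i) \<and>
    (\<forall>u. cmod (z - l) * L2_set (\<lambda>i. cmod (u i)) I \<le> L2_set (\<lambda>i. cmod (mvec I A u i - l * u i)) I)"
proof -
  define y where "y = \<i> * of_real (Im l)"
  define B where "B i j = A i j - (if i = j then y else 0)" for i j
  have B: "mvec I B u i = mvec I A u i - y * u i" if "i \<in> I" for u i
  proof -
    have "mvec I B u i = mvec I A u i - (\<Sum>j\<in>I. if i = j then y * u j else 0)"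
      unfolding mvec_def sum_subtractf[symmetric] by (intro sum.cong) (auto simp: B_def algebra_simps)
    then show ?thesis using that \<open>finite I\<close> by simp
  qed
  have skewB: "\<forall>i\<in>I. \<forall>j\<in>I. B i j = - cnj (B j i)"
  proof (intro ballI)
    fix i j assume "i \<in> I" "j \<in> I"
    then have "A i j = - cnj (A j i)" using skew by blast
    then show "B i j = - cnj (B j i)" by (simp add: B_def y_def)
  qed
  obtain z w where z: "\<exists>i\<in>I. w i \<noteq> 0" "\<forall>i\<in>I. mvec I B w i = z * w i" "Re z = 0"
    "\<forall>u. (cmod z)\<^sup>2 * (\<Sum>i\<in>I. (cmod (u i))\<^sup>2) \<le> (\<Sum>i\<in>I. (cmod (mvec I B u i))\<^sup>2)"
    using skew_hermitian_smallest_eigenvalue[OF assms(1,2) skewB] by (elim exE conjE) (rule that)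
  have "cmod (z + y - l) * L2_set (\<lambda>i. cmod (u i)) I \<le> L2_set (\<lambda>i. cmod (mvec I A u i - l * u i)) I" for u
  proof -
    have "Re (cip I (mvec I B u) u) = 0"
    proof -
      have "cip I (mvec I B u) u = - cnj (cip I (mvec I B u) u)"
        using cip_mvec_skew[OF skewB, of u u] by (simp add: cnj_cip)
      then have "Re (cip I (mvec I B u) u) = - Re (cip I (mvec I B u) u)"
        by (metis cnj.simps(1) uminus_complex.simps(1))
      then show ?thesis by simp
    qed
    then have cross: "(\<Sum>i\<in>I. Re (mvec I B u i * cnj (u i))) = 0"
      by (simp add: cip_def)
    have nl: "(cmod (z + y - l))\<^sup>2 = (cmod z)\<^sup>2 + (Re l)\<^sup>2"
      using z(3) by (simp add: cmod_power2 y_def)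
    have "(\<Sum>i\<in>I. (cmod (mvec I A u i - l * u i))\<^sup>2)
        = (\<Sum>i\<in>I. (cmod (mvec I B u i))\<^sup>2 + (Re l)\<^sup>2 * (cmod (u i))\<^sup>2
             - 2 * Re l * Re (mvec I B u i * cnj (u i)))"
    proof (intro sum.cong refl)
      fix i assume "i \<in> I"
      then have eq: "mvec I A u i - l * u i = mvec I B u i - of_real (Re l) * u i"
        by (simp add: B y_def complex_eq_iff algebra_simps)
      then show "(cmod (mvec I A u i - l * u i))\<^sup>2 = (cmod (mvec I B u i))\<^sup>2 + (Re l)\<^sup>2 * (cmod (u i))\<^sup>2
             - 2 * Re l * Re (mvec I B u i * cnj (u i))"
        unfolding eq cmod_power2 by (simp add: algebra_simps power2_eq_square)
    qed
    also have "\<dots> = (\<Sum>i\<in>I. (cmod (mvec I B u i))\<^sup>2) + (Re l)\<^sup>2 * (\<Sum>i\<in>I. (cmod (u i))\<^sup>2)"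
      using cross by (simp add: sum.distrib sum_subtractf flip: sum_distrib_left)
    also have "\<dots> \<ge> (cmod (z + y - l))\<^sup>2 * (\<Sum>i\<in>I. (cmod (u i))\<^sup>2)"
      unfolding nl using z(4)[rule_format, of u] by (simp add: algebra_simps)
    finally show ?thesis
      unfolding L2_set_def by (intro real_le_rsqrt) (simp add: power_mult_distrib sum_nonneg)
  qed
  then have "\<forall>u. cmod (z + y - l) * L2_set (\<lambda>i. cmod (u i)) I \<le> L2_set (\<lambda>i. cmod (mvec I A u i - l * u i)) I"
    by (rule allI)
  moreover have "\<forall>i\<in>I. mvec I A w i = (z + y) * w i"
    using z(2) by (simp add: B algebra_simps)
  ultimately show ?thesis using z(1) by (intro exI[of _ "z + y"] exI[of _ w] conjI)
qed

section \<open>Entry-sum bounds and the dichotomy for eigenvalues\<close>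

lemma norm_sum_mult_le_L2_set:
  fixes c :: "'i \<Rightarrow> complex"
  assumes "finite I"
  shows "cmod (\<Sum>j\<in>I. c j * x j) \<le> (\<Sum>j\<in>I. cmod (c j)) * L2_set (\<lambda>j. cmod (x j)) I"
  unfolding sum_distrib_right
  by (intro sum_norm_le) (auto simp: norm_mult assms intro!: mult_left_mono member_le_L2_set)

text \<open>The sum of the moduli of the entries stands in for the operator norm: the rates only
  require a bound independent of \<open>x\<close>. The two index sets may differ, so off-diagonal
  blocks are covered.\<close>

lemma L2_set_mvec_le:
  assumes "finite I" "finite J"
  shows "L2_set (\<lambda>i. cmod (mvec J A x i)) I \<le> (\<Sum>i\<in>I. \<Sum>j\<in>J. cmod (A i j)) * L2_set (\<lambda>j. cmod (x j)) J"
proof -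
  have "L2_set (\<lambda>i. cmod (mvec J A x i)) I \<le> (\<Sum>i\<in>I. cmod (mvec J A x i))"
    by (rule L2_set_le_sum) simp
  also have "\<dots> \<le> (\<Sum>i\<in>I. (\<Sum>j\<in>J. cmod (A i j)) * L2_set (\<lambda>j. cmod (x j)) J)"
    unfolding mvec_def by (intro sum_mono norm_sum_mult_le_L2_set assms)
  finally show ?thesis by (simp add: sum_distrib_right)
qed

lemma norm_cip_le:
  "cmod (cip I u v) \<le> L2_set (\<lambda>i. cmod (u i)) I * L2_set (\<lambda>i. cmod (v i)) I"
proof -
  have "cmod (cip I u v) \<le> (\<Sum>i\<in>I. \<bar>cmod (u i)\<bar> * \<bar>cmod (v i)\<bar>)"
    unfolding cip_def by (intro sum_norm_le) (simp add: norm_mult)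
  also have "\<dots> \<le> L2_set (\<lambda>i. cmod (u i)) I * L2_set (\<lambda>i. cmod (v i)) I"
    by (rule L2_set_mult_ineq)
  finally show ?thesis .
qed

text \<open>Gives the upper bound of order \<tau> for the eigenvalues that diverge.\<close>

lemma eigenvalue_norm_le:
  assumes "finite I" "\<exists>i\<in>I. x i \<noteq> 0" "\<forall>i\<in>I. mvec I A x i = l * x i"
  shows "cmod l \<le> (\<Sum>i\<in>I. \<Sum>j\<in>I. cmod (A i j))"
proof -
  have "cmod l * L2_set (\<lambda>i. cmod (x i)) I = L2_set (\<lambda>i. cmod (mvec I A x i)) I"
    using assms(3) by (simp add: L2_set_left_distrib norm_mult L2_set_right_distrib cong: L2_set_cong)
  also have "\<dots> \<le> (\<Sum>i\<in>I. \<Sum>j\<in>I. cmod (A i j)) * L2_set (\<lambda>i. cmod (x i)) I"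
    by (rule L2_set_mvec_le) fact+
  finally have "cmod l * L2_set (\<lambda>i. cmod (x i)) I \<le> \<dots>" .
  moreover have "L2_set (\<lambda>i. cmod (x i)) I > 0"
    using assms(1,2) by (auto simp: less_le L2_set_eq_0_iff)
  ultimately show ?thesis by simp
qed

text \<open>Pairing the second block of the eigenvalue equation with the eigenvector bounds the second
  block of the eigenvector by \<open>O(1/\<tau>)\<close> times the first one unless \<open>Re l < - \<tau> s / 2\<close>; the
  first block is then an approximate eigenvector of the skew block.\<close>

lemma penalised_eigenvalue_cases:
  fixes K S :: "'i \<Rightarrow> 'i \<Rightarrow> real"
  assumes fin: "finite C" "finite N" and disj: "C \<inter> N = {}"
    and skew: "\<forall>i\<in>C \<union> N. \<forall>j\<in>C \<union> N. K i j = - K j i"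
    and S0: "\<And>i j. i \<in> C \<or> j \<in> C \<Longrightarrow> S i j = 0"
    and pd: "s > 0" "\<And>v. s * (\<Sum>i\<in>N. (v i)\<^sup>2) \<le> (\<Sum>i\<in>N. \<Sum>j\<in>N. v i * S i j * v j)"
  shows "\<exists>c. \<forall>\<tau>>0. \<forall>l x. (\<exists>i\<in>C \<union> N. x i \<noteq> 0) \<longrightarrow>
    (\<forall>i\<in>C \<union> N. mvec (C \<union> N) (\<lambda>i j. of_real (K i j - \<tau> * S i j)) x i = l * x i) \<longrightarrow>
    Re l < - (\<tau> * s / 2) \<or>
    (\<exists>z w. (\<exists>i\<in>C. w i \<noteq> 0) \<and> (\<forall>i\<in>C. mvec C (\<lambda>i j. of_real (K i j)) w i = z * w i) \<and>
       cmod (z - l) \<le> c / \<tau>)"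
proof -
  define \<beta> where "\<beta> = (\<Sum>i\<in>C. \<Sum>j\<in>N. \<bar>K i j\<bar>)"
  have "\<beta> \<ge> 0" by (simp add: \<beta>_def sum_nonneg)
  define Kc Sc where "Kc i j = complex_of_real (K i j)" and "Sc i j = complex_of_real (S i j)" for i j
  show ?thesis
  \<comment> \<open>One factor \<open>\<beta>\<close> bounds the block of \<open>K\<close> acting on
    the second part of the eigenvector; the factor \<open>2 * \<beta> / s\<close> comes from the
    bound on that part in \<open>le\<close> below.\<close>
  proof (intro exI[of _ "2 * \<beta>\<^sup>2 / s"] allI impI, goal_cases)
    case (1 \<tau> l x)
    define a b where "a = L2_set (\<lambda>i. cmod (x i)) C" and "b = L2_set (\<lambda>i. cmod (x i)) N"
    have ab: "a \<ge> 0" "b \<ge> 0" by (auto simp: a_def b_def L2_set_nonneg)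
    have eq: "mvec C Kc x i + mvec N Kc x i - of_real \<tau> * mvec N Sc x i = l * x i" if "i \<in> C \<union> N" for i
    proof -
      have "(\<Sum>j\<in>C. of_real \<tau> * (x j * complex_of_real (S i j))) = 0"
        by (intro sum.neutral) (simp add: S0)
      then show ?thesis
        using 1(3) that fin disj
        by (simp add: mvec_def Kc_def Sc_def sum.union_disjoint algebra_simps sum_subtractf sum_distrib_left)
    qed
    have SC: "mvec N Sc x i = 0" if "i \<in> C" for i
      unfolding mvec_def Sc_def using that by (intro sum.neutral) (simp add: S0)
    have bb: "(\<Sum>i\<in>N. (cmod (x i))\<^sup>2) = b\<^sup>2"
      by (simp add: b_def L2_set_def sum_nonneg)
    \<comment> \<open>The pairing yields
      \<open>Re l * b^2 \<le> \<beta> * a * b - \<tau> * s * b^2\<close>. The assumption on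
      \<open>Re l\<close> uses up half of the damping, and one factor \<open>b\<close>
      cancels.\<close>
    have le: "b * (\<tau> * s / 2) \<le> \<beta> * a" if "Re l \<ge> - (\<tau> * s / 2)"
    proof -
      have "Re (cip N (mvec N Kc x) x) = 0"
      proof -
        have sk: "\<forall>i\<in>N. \<forall>j\<in>N. Kc i j = - cnj (Kc j i)"
        proof (intro ballI)
          fix i j assume "i \<in> N" "j \<in> N"
          then have "K i j = - K j i" using skew by blast
          then show "Kc i j = - cnj (Kc j i)" by (simp add: Kc_def)
        qed
        have "cip N (mvec N Kc x) x = - cnj (cip N (mvec N Kc x) x)"
          using cip_mvec_skew[OF sk, of x x] by (simp add: cnj_cip)
        then have "Re (cip N (mvec N Kc x) x) = - Re (cip N (mvec N Kc x) x)"
          by (metis cnj.simps(1) uminus_complex.simps(1))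
        then show ?thesis by simp
      qed
      moreover have "Re (cip N (mvec N Sc x) x) \<ge> s * b\<^sup>2"
      proof -
        \<comment> \<open>As \<open>S\<close> is real, the real part splits into the form at
          \<open>Re x\<close> and the form at \<open>Im x\<close>, so the hypothesis
          \<open>pd\<close> on real vectors applies to each.\<close>
        have "Re (cip N (mvec N Sc x) x) = (\<Sum>i\<in>N. \<Sum>j\<in>N. Re (x i) * S i j * Re (x j))
            + (\<Sum>i\<in>N. \<Sum>j\<in>N. Im (x i) * S i j * Im (x j))"
          by (simp add: cip_def mvec_def Sc_def sum_distrib_left sum.distrib mult_ac)
        also have "\<dots> \<ge> s * (\<Sum>i\<in>N. (Re (x i))\<^sup>2) + s * (\<Sum>i\<in>N. (Im (x i))\<^sup>2)"
          by (intro add_mono pd)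
        also have "s * (\<Sum>i\<in>N. (Re (x i))\<^sup>2) + s * (\<Sum>i\<in>N. (Im (x i))\<^sup>2) = s * b\<^sup>2"
          unfolding bb[symmetric] cmod_power2 by (simp add: sum.distrib algebra_simps)
        finally show ?thesis .
      qed
      moreover have "Re (cip N (mvec C Kc x) x) \<le> \<beta> * a * b"
      proof -
        have "Re (cip N (mvec C Kc x) x) \<le> L2_set (\<lambda>i. cmod (mvec C Kc x i)) N * b"
          unfolding b_def by (rule order_trans[OF complex_Re_le_cmod norm_cip_le])
        also have "\<dots> \<le> (\<Sum>i\<in>N. \<Sum>j\<in>C. cmod (Kc i j)) * a * b"
          unfolding a_def using ab by (intro mult_right_mono L2_set_mvec_le fin)
        \<comment> \<open>Skewness makes the two off-diagonal blocks equal in size, so one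
          \<open>\<beta>\<close> bounds both.\<close>
        also have "(\<Sum>i\<in>N. \<Sum>j\<in>C. cmod (Kc i j)) = (\<Sum>i\<in>N. \<Sum>j\<in>C. \<bar>K j i\<bar>)"
        proof (intro sum.cong refl)
          fix i j assume "i \<in> N" "j \<in> C"
          then have "K i j = - K j i" using skew by blast
          then show "cmod (Kc i j) = \<bar>K j i\<bar>" by (simp add: Kc_def)
        qed
        also have "\<dots> = \<beta>" unfolding \<beta>_def by (rule sum.swap)
        finally show ?thesis .
      qed
      moreover have "Re l * b\<^sup>2 = Re (cip N (mvec C Kc x) x) + Re (cip N (mvec N Kc x) x)
          - \<tau> * Re (cip N (mvec N Sc x) x)"
      proof -
        have "l * cip N x x = cip N (\<lambda>i. mvec C Kc x i + mvec N Kc x i - of_real \<tau> * mvec N Sc x i) x"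
          unfolding cip_scale_left[symmetric] by (intro cip_cong) (simp_all add: eq)
        then have "l * of_real (b\<^sup>2) = cip N (mvec C Kc x) x + cip N (mvec N Kc x) x
          - of_real \<tau> * cip N (mvec N Sc x) x"
          by (simp only: cip_self bb cip_diff_left cip_add_left cip_scale_left)
        from arg_cong[OF this, of Re] show ?thesis by simp
      qed
      moreover have "- (\<tau> * s / 2) * b\<^sup>2 \<le> Re l * b\<^sup>2"
        using that by (rule mult_right_mono) simp
      moreover have "\<tau> * (s * b\<^sup>2) \<le> \<tau> * Re (cip N (mvec N Sc x) x)"
        using 1(1) calculation(2) by simp
      ultimately have "b * (b * (\<tau> * s / 2)) \<le> b * (\<beta> * a)"
        by (simp add: power2_eq_square algebra_simps)
      then show ?thesis
        using ab \<open>\<beta> \<ge> 0\<close> by (cases "b = 0") (auto simp: mult_le_cancel_left)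
    qed
    show ?case
    proof (cases "Re l < - (\<tau> * s / 2)")
      case False
      then have le: "b * (\<tau> * s / 2) \<le> \<beta> * a" using le by simp
      \<comment> \<open>If the first part vanished, \<open>le\<close> would make the second vanish
        too. This permits division by \<open>a\<close> and shows that \<open>C\<close> is
        nonempty.\<close>
      have "a > 0"
      proof (rule ccontr)
        assume "\<not> a > 0"
        then have "a = 0" using ab by simp
        then have "b = 0" using le 1(1) pd(1) ab by (simp add: mult_le_0_iff)
        with \<open>a = 0\<close> 1(2) fin show False
          unfolding a_def b_def by (auto simp: L2_set_eq_0_iff)
      qed
      then have "C \<noteq> {}" by (auto simp: a_def)
      have sk: "\<forall>i\<in>C. \<forall>j\<in>C. Kc i j = - cnj (Kc j i)"
      proof (intro ballI)
        fix i j assume "i \<in> C" "j \<in> C"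
        then have "K i j = - K j i" using skew by blast
        then show "Kc i j = - cnj (Kc j i)" by (simp add: Kc_def)
      qed
      obtain z w where zw: "\<exists>i\<in>C. w i \<noteq> 0" "\<forall>i\<in>C. mvec C Kc w i = z * w i"
        "\<forall>u. cmod (z - l) * L2_set (\<lambda>i. cmod (u i)) C \<le> L2_set (\<lambda>i. cmod (mvec C Kc u i - l * u i)) C"
        using skew_hermitian_eigenvalue_near[OF fin(1) \<open>C \<noteq> {}\<close> sk, of l] by (elim exE conjE) (rule that)
      have "cmod (z - l) * a \<le> L2_set (\<lambda>i. cmod (mvec C Kc x i - l * x i)) C"
        unfolding a_def by (rule zw(3)[rule_format])
      also have "\<dots> = L2_set (\<lambda>i. cmod (mvec N Kc x i)) C"
      proof (intro L2_set_cong refl)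
        fix i assume "i \<in> C"
        then have "mvec C Kc x i - l * x i = - mvec N Kc x i"
          using eq[of i] SC[of i] by (simp add: algebra_simps flip: add_eq_0_iff)
        then show "cmod (mvec C Kc x i - l * x i) = cmod (mvec N Kc x i)" by simp
      qed
      also have "\<dots> \<le> (\<Sum>i\<in>C. \<Sum>j\<in>N. cmod (Kc i j)) * b"
        unfolding b_def by (intro L2_set_mvec_le fin)
      also have "(\<Sum>i\<in>C. \<Sum>j\<in>N. cmod (Kc i j)) = \<beta>" by (simp add: \<beta>_def Kc_def)
      finally have "cmod (z - l) * a \<le> \<beta> * b" .
      also have "\<dots> \<le> \<beta> * (2 * \<beta> * a / (\<tau> * s))"
        using le 1(1) pd(1) \<open>\<beta> \<ge> 0\<close> by (intro mult_left_mono) (auto simp: field_simps)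
      also have "\<dots> = 2 * \<beta>\<^sup>2 / s / \<tau> * a" by (simp add: power2_eq_square mult_ac)
      finally have "cmod (z - l) \<le> 2 * \<beta>\<^sup>2 / s / \<tau>"
        using \<open>a > 0\<close> by (simp only: mult_le_cancel_right_pos)
      then show ?thesis using zw(1,2) unfolding Kc_def by blast
    qed simp
  qed
qed

subsection \<open>Characteristic polynomials\<close>

lemma det_scale_rows:
  fixes A :: "'a::comm_ring_1 Matrix.mat"
  assumes A: "A \<in> carrier_mat n n"
  shows "Determinant.det (Matrix.mat n n (\<lambda>(i, j). c i * A $$ (i, j))) = (\<Prod>i<n. c i) * Determinant.det A"
proof -
  have "(\<Prod>i = 0..<n. Matrix.mat n n (\<lambda>(i, j). c i * A $$ (i, j)) $$ (i, p i)) =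
      (\<Prod>i<n. c i) * (\<Prod>i = 0..<n. A $$ (i, p i))" if "p permutes {0..<n}" for p
  proof -
    have "p i < n" if "i < n" for i
      using permutes_in_image[OF \<open>p permutes {0..<n}\<close>, of i] that by simp
    then have "(\<Prod>i = 0..<n. Matrix.mat n n (\<lambda>(i, j). c i * A $$ (i, j)) $$ (i, p i)) =
      (\<Prod>i = 0..<n. c i * A $$ (i, p i))"
      by (intro prod.cong) auto
    then show ?thesis by (simp add: prod.distrib atLeast0LessThan)
  qed
  then show ?thesis
    by (simp add: det_def'[OF A] det_def'[OF mat_carrier] sum_distrib_left mult.left_commute)
qed

lemma tendsto_coeff_mult:
  fixes p q :: "'b \<Rightarrow> 'a::{comm_semiring_0, topological_semigroup_mult, topological_comm_monoid_add} poly"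
  assumes "\<And>k. ((\<lambda>t. coeff (p t) k) \<longlongrightarrow> coeff p' k) F"
    and "\<And>k. ((\<lambda>t. coeff (q t) k) \<longlongrightarrow> coeff q' k) F"
  shows "((\<lambda>t. coeff (p t * q t) k) \<longlongrightarrow> coeff (p' * q') k) F"
  unfolding coeff_mult by (intro tendsto_sum tendsto_mult assms)

lemma tendsto_coeff_prod:
  fixes p :: "'i \<Rightarrow> 'b \<Rightarrow> 'a::real_normed_field poly"
  assumes "\<And>i k. i \<in> I \<Longrightarrow> ((\<lambda>t. coeff (p i t) k) \<longlongrightarrow> coeff (p' i) k) F"
  shows "((\<lambda>t. coeff (\<Prod>i\<in>I. p i t) k) \<longlongrightarrow> coeff (\<Prod>i\<in>I. p' i) k) F"
  using assms
proof (induction I arbitrary: k rule: infinite_finite_induct)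
  case (insert i I)
  then show ?case by (simp add: tendsto_coeff_mult)
qed auto

text \<open>By the Leibniz formula the determinant consists of finite sums and products of entries,
  which preserve coefficientwise limits.\<close>

lemma tendsto_coeff_det:
  fixes A :: "'b \<Rightarrow> 'a::real_normed_field poly Matrix.mat"
  assumes "\<And>t. A t \<in> carrier_mat n n" "L \<in> carrier_mat n n"
    and "\<And>i j k. i < n \<Longrightarrow> j < n \<Longrightarrow> ((\<lambda>t. coeff (A t $$ (i, j)) k) \<longlongrightarrow> coeff (L $$ (i, j)) k) F"
  shows "((\<lambda>t. coeff (Determinant.det (A t)) k) \<longlongrightarrow> coeff (Determinant.det L) k) F"
  unfolding det_def'[OF assms(1)] det_def'[OF assms(2)] coeff_sum
proof (intro tendsto_sum tendsto_coeff_mult tendsto_coeff_prod tendsto_const assms(3))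
  fix p i assume "p \<in> {p. p permutes {0..<n}}" "i \<in> {0..<n}"
  then show "i < n" "p i < n"
    using permutes_in_image[of p "{0..<n}" i] by auto
qed

text \<open>Evaluation at any point commutes with the determinant and turns the constant entries
  back into those of \<open>A\<close>.\<close>

lemma det_const_poly_mat:
  fixes A :: "'a::{idom, ring_char_0} Matrix.mat"
  assumes "A \<in> carrier_mat n n"
  shows "Determinant.det (map_mat (\<lambda>a. [:a:]) A) = [:Determinant.det A:]"
proof -
  have "poly (Determinant.det (map_mat (\<lambda>a. [:a:]) A)) x = poly [:Determinant.det A:] x" for x
    using poly_det_cong[OF assms, of "map_mat (\<lambda>a. [:a:]) A" x] assms by simp
  then show ?thesis by (simp add: poly_eq_poly_eq_iff[symmetric] fun_eq_iff)
qed

text \<open>Dividing the last \<open>nN\<close> rows of the characteristic matrix by \<open>\<tau>\<close> makes it converge to a block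
  triangular matrix with diagonal blocks \<open>x - A\<close> and \<open>S\<close>.\<close>

lemma char_poly_penalised_tendsto:
  fixes K S :: "nat \<Rightarrow> nat \<Rightarrow> real" and M :: "real \<Rightarrow> complex Matrix.mat" and A T :: "complex Matrix.mat"
    and nC nN :: nat
  defines "M \<equiv> \<lambda>\<tau>. Matrix.mat (nC + nN) (nC + nN) (\<lambda>(i, j). complex_of_real (K i j - \<tau> * S i j))"
    and "A \<equiv> Matrix.mat nC nC (\<lambda>(i, j). complex_of_real (K i j))"
    and "T \<equiv> Matrix.mat nN nN (\<lambda>(i, j). complex_of_real (S (nC + i) (nC + j)))"
  assumes S0: "\<And>i j. i < nC \<or> j < nC \<Longrightarrow> S i j = 0"
  shows "((\<lambda>\<tau>. coeff (Polynomial.smult (complex_of_real (1 / \<tau>) ^ nN) (char_poly (M \<tau>))) k)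
    \<longlongrightarrow> coeff (Polynomial.smult (Determinant.det T) (char_poly A)) k) at_top"
proof -
  define n where "n = nC + nN"
  define c where "c \<tau> i = (if i < nC then 1 else [:complex_of_real (1 / \<tau>):])" for \<tau> i
  define X where "X \<tau> = Matrix.mat n n (\<lambda>(i, j). c \<tau> i * char_poly_matrix (M \<tau>) $$ (i, j))" for \<tau>
  \<comment> \<open>The lower left block is zero: \<open>S\<close> vanishes in the first
    \<open>nC\<close> columns, and the rest of these rows is divided by \<tau>. Hence the
    determinant of the limit factorises.\<close>
  define L where "L = four_block_mat (char_poly_matrix A)
      (Matrix.mat nC nN (\<lambda>(i, j). [:- complex_of_real (K i (nC + j)):])) (0\<^sub>m nN nC) (map_mat (\<lambda>a. [:a:]) T)"
  have carr: "M \<tau> \<in> carrier_mat n n" "A \<in> carrier_mat nC nC" "T \<in> carrier_mat nN nN" for \<tau>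
    by (auto simp: M_def A_def T_def n_def)
  have L: "L \<in> carrier_mat n n"
    unfolding L_def n_def by (intro four_block_carrier_mat char_poly_matrix_closed carr) (use carr in auto)
  have detL: "Determinant.det L = Polynomial.smult (Determinant.det T) (char_poly A)"
    unfolding L_def char_poly_def
    by (subst det_four_block_mat_lower_left_zero[where n = nC and m = nN])
       (use carr in \<open>auto simp: det_const_poly_mat mult.commute\<close>)
  have detX: "Determinant.det (X \<tau>) = Polynomial.smult (complex_of_real (1 / \<tau>) ^ nN) (char_poly (M \<tau>))" for \<tau>
  proof -
    have "(\<Prod>i<n. c \<tau> i) = (\<Prod>i\<in>{nC..<n}. c \<tau> i)"
      by (intro prod.mono_neutral_right) (auto simp: c_def)
    also have "\<dots> = (\<Prod>i\<in>{nC..<n}. [:complex_of_real (1 / \<tau>):])"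
      by (intro prod.cong) (auto simp: c_def)
    also have "\<dots> = [:complex_of_real (1 / \<tau>) ^ nN:]"
      by (simp add: n_def poly_const_pow)
    finally show ?thesis
      unfolding X_def char_poly_def by (subst det_scale_rows) (use carr in auto)
  qed
  have "((\<lambda>\<tau>. coeff (X \<tau> $$ (i, j)) k) \<longlongrightarrow> coeff (L $$ (i, j)) k) at_top" if ij: "i < n" "j < n" for i j k
  proof -
    have X: "X \<tau> $$ (i, j) = c \<tau> i * ((if i = j then [:0, 1:] else 0) + [:- complex_of_real (K i j - \<tau> * S i j):])" for \<tau>
      using ij carr(1)[of \<tau>] by (simp add: X_def char_poly_matrix_def M_def n_def)
    show ?thesis
    proof (cases "i < nC")
      case True
      \<comment> \<open>These rows are not scaled and contain no \<open>S\<close>, so they equal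
        their limit for every \<tau>.\<close>
      have "X \<tau> $$ (i, j) = L $$ (i, j)" for \<tau>
        unfolding X using True ij carr
        by (auto simp: L_def c_def S0 n_def char_poly_matrix_def A_def)
      then show ?thesis by simp
    next
      case False
      have Lij: "L $$ (i, j) = [:complex_of_real (S i j):]"
        using False ij carr
        by (auto simp: L_def S0 n_def char_poly_matrix_def T_def not_less)
      have t0: "((\<lambda>\<tau>. 1 / \<tau>) \<longlongrightarrow> (0::real)) at_top"
        by (rule real_tendsto_divide_at_top[OF tendsto_const filterlim_ident])
      have "((\<lambda>\<tau>. complex_of_real (S i j - (1 / \<tau>) * K i j)) \<longlongrightarrow> complex_of_real (S i j - 0 * K i j)) at_top"
        by (intro tendsto_intros t0)
      moreover have "\<forall>\<^sub>F \<tau> in at_top. complex_of_real (S i j - (1 / \<tau>) * K i j) = coeff (X \<tau> $$ (i, j)) 0"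
        using eventually_gt_at_top[of 0]
        by eventually_elim (use False in \<open>simp add: X c_def field_simps\<close>)
      ultimately have c0: "((\<lambda>\<tau>. coeff (X \<tau> $$ (i, j)) 0) \<longlongrightarrow> complex_of_real (S i j)) at_top"
        by (simp add: tendsto_cong)
      \<comment> \<open>In the scaled rows the variable survives only as x/\<tau> on the diagonal,
        which disappears in the limit; this is where the degree drops.\<close>
      have cs: "coeff (X \<tau> $$ (i, j)) (Suc k) = complex_of_real (1 / \<tau>) * (if i = j \<and> k = 0 then 1 else 0)" for \<tau> k
        using False by (simp add: X c_def coeff_pCons split: nat.splits)
      have "((\<lambda>\<tau>. complex_of_real (1 / \<tau>) * (if i = j \<and> k = 0 then 1 else 0)) \<longlongrightarrow>
          complex_of_real 0 * (if i = j \<and> k = 0 then 1 else 0)) at_top" for k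
        by (intro tendsto_intros t0)
      then have "((\<lambda>\<tau>. coeff (X \<tau> $$ (i, j)) (Suc k)) \<longlongrightarrow> 0) at_top" for k
        unfolding cs by (simp only: of_real_0 mult_zero_left)
      with c0 show ?thesis by (cases k) (auto simp: Lij)
    qed
  qed
  then have "((\<lambda>\<tau>. coeff (Determinant.det (X \<tau>)) k) \<longlongrightarrow> coeff (Determinant.det L) k) at_top"
    by (intro tendsto_coeff_det[OF _ L]) (auto simp: X_def)
  then show ?thesis by (simp add: detX detL)
qed

text \<open>The passage from characteristic polynomials, which count multiplicities, to eigenvector
  equations on plain functions, where the estimates are made.\<close>

lemma char_poly_root_iff:
  fixes f :: "nat \<Rightarrow> nat \<Rightarrow> complex"
  shows "z \<in># proots (char_poly (Matrix.mat n n (\<lambda>(i, j). f i j))) \<longleftrightarrow>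
    (\<exists>u. (\<exists>i<n. u i \<noteq> 0) \<and> (\<forall>i<n. (\<Sum>j<n. f i j * u j) = z * u i))"
proof -
  define A where "A = Matrix.mat n n (\<lambda>(i, j). f i j)"
  have A: "A \<in> carrier_mat n n" by (simp add: A_def)
  have "char_poly A \<noteq> 0" using degree_monic_char_poly[OF A] by auto
  then have "z \<in># proots (char_poly A) \<longleftrightarrow> (\<exists>v. eigenvector A v z)"
    using eigenvalue_root_char_poly[OF A, of z] by (simp add: eigenvalue_def)
  also have "\<dots> \<longleftrightarrow> (\<exists>u. (\<exists>i<n. u i \<noteq> 0) \<and> (\<forall>i<n. (\<Sum>j<n. f i j * u j) = z * u i))"
  proof
    assume "\<exists>v. eigenvector A v z"
    then obtain v where v: "v \<in> carrier_vec n" "v \<noteq> 0\<^sub>v n" "A *\<^sub>v v = z \<cdot>\<^sub>v v"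
      using A by (auto simp: eigenvector_def)
    have "\<exists>i<n. vec_index v i \<noteq> 0"
      using v(1,2) by (metis carrier_vecD eq_vecI index_zero_vec)
    moreover have "(\<Sum>j<n. f i j * vec_index v j) = z * vec_index v i" if "i < n" for i
      using arg_cong[OF v(3), of "\<lambda>w. vec_index w i"] that v(1)
      by (simp add: A_def scalar_prod_def atLeast0LessThan)
    ultimately show "\<exists>u. (\<exists>i<n. u i \<noteq> 0) \<and> (\<forall>i<n. (\<Sum>j<n. f i j * u j) = z * u i)"
      by blast
  next
    assume "\<exists>u. (\<exists>i<n. u i \<noteq> 0) \<and> (\<forall>i<n. (\<Sum>j<n. f i j * u j) = z * u i)"
    then obtain u where u: "\<exists>i<n. u i \<noteq> 0" "\<forall>i<n. (\<Sum>j<n. f i j * u j) = z * u i"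
      by blast
    have "Matrix.vec n u \<noteq> 0\<^sub>v n"
      using u(1) by (metis index_vec index_zero_vec(1))
    moreover have "A *\<^sub>v Matrix.vec n u = z \<cdot>\<^sub>v Matrix.vec n u"
      using u(2) by (intro eq_vecI) (auto simp: A_def scalar_prod_def atLeast0LessThan)
    ultimately show "\<exists>v. eigenvector A v z"
      using A by (intro exI[of _ "Matrix.vec n u"]) (auto simp: eigenvector_def)
  qed
  finally show ?thesis by (simp add: A_def)
qed

text \<open>A kernel vector would annihilate the quadratic form. The argument is made over the
  reals, where kernel vectors are real, and then transferred. It keeps the limit polynomial nonzero,
  so that exactly as many roots escape as the block has rows.\<close>

lemma det_pos_def_nonzero:
  fixes S :: "nat \<Rightarrow> nat \<Rightarrow> real"
  assumes "\<And>v. \<exists>i<n. v i \<noteq> 0 \<Longrightarrow> 0 < (\<Sum>i<n. \<Sum>j<n. v i * S i j * v j)"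
  shows "Determinant.det (Matrix.mat n n (\<lambda>(i, j). complex_of_real (S i j))) \<noteq> 0"
proof -
  define T where "T = Matrix.mat n n (\<lambda>(i, j). S i j)"
  have T: "T \<in> carrier_mat n n" by (simp add: T_def)
  have "Determinant.det T \<noteq> 0"
  proof
    assume "Determinant.det T = 0"
    then obtain v where v: "v \<in> carrier_vec n" "v \<noteq> 0\<^sub>v n" "T *\<^sub>v v = 0\<^sub>v n"
      using det_0_iff_vec_prod_zero[OF T] by blast
    have "\<exists>i<n. vec_index v i \<noteq> 0"
      using v(1,2) by (metis carrier_vecD eq_vecI index_zero_vec)
    moreover have "(\<Sum>j<n. S i j * vec_index v j) = 0" if "i < n" for i
      using arg_cong[OF v(3), of "\<lambda>w. vec_index w i"] that v(1)
      by (simp add: T_def scalar_prod_def atLeast0LessThan)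
    then have "(\<Sum>i<n. \<Sum>j<n. vec_index v i * S i j * vec_index v j) = 0"
      by (simp add: mult.assoc flip: sum_distrib_left)
    ultimately show False using assms[of "vec_index v"] by simp
  qed
  moreover have "map_mat complex_of_real T = Matrix.mat n n (\<lambda>(i, j). complex_of_real (S i j))"
    by (intro eq_matI) (auto simp: T_def)
  ultimately show ?thesis
    by (metis of_real_hom.hom_det of_real_eq_0_iff)
qed

subsection \<open>Decoupling of the spectrum\<close>

lemma ex_image_mset_lessThan:
  assumes "size M = n"
  shows "\<exists>g. image_mset g (mset_set {..<n}) = M"
proof -
  obtain xs where xs: "mset xs = M" using ex_mset by blast
  have "image_mset ((!) xs) (mset_set {..<length xs}) = mset (map ((!) xs) [0..<length xs])"
    by (simp add: atLeast0LessThan)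
  then have "image_mset ((!) xs) (mset_set {..<n}) = M"
    using assms xs by (simp only: map_nth) auto
  then show ?thesis by blast
qed

text \<open>Points of \<open>Z\<close> other than \<open>a\<close> keep a distance \<open>d\<close>
  from \<open>a\<close>. Once \<open>f t\<close> is within \<open>d / 2\<close> of \<open>a\<close>
  and \<open>c / t < d / 2\<close>, the nearby point of \<open>Z\<close> can only be
  \<open>a\<close>.\<close>

lemma bound_at_near_of_tendsto:
  fixes f :: "real \<Rightarrow> complex"
  assumes "(f \<longlongrightarrow> a) at_top" "finite Z"
    and near: "\<forall>\<^sub>F t in at_top. \<exists>z\<in>Z. cmod (z - f t) \<le> c / t"
  shows "\<forall>\<^sub>F t in at_top. cmod (f t - a) \<le> c / t"
proof -
  obtain d where d: "d > 0" "\<And>z. z \<in> Z \<Longrightarrow> z \<noteq> a \<Longrightarrow> d \<le> dist a z"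
    using finite_set_avoid[OF assms(2), of a] by blast
  have "((\<lambda>t. c / t) \<longlongrightarrow> 0) at_top"
    by (rule real_tendsto_divide_at_top[OF tendsto_const filterlim_ident])
  then have "\<forall>\<^sub>F t in at_top. c / t < d / 2"
    by (rule order_tendstoD) (use d in simp)
  moreover have "\<forall>\<^sub>F t in at_top. dist (f t) a < d / 2"
    using assms(1) d(1) by (intro tendstoD) auto
  ultimately show ?thesis using near
  proof eventually_elim
    case (elim t)
    then obtain z where z: "z \<in> Z" "cmod (z - f t) \<le> c / t" by blast
    have "dist a z \<le> dist (f t) a + dist (f t) z" by (rule dist_triangle3)
    moreover have "dist (f t) z = cmod (z - f t)" by (simp add: dist_norm norm_minus_commute)
    ultimately have "dist a z < d" using z(2) elim(1,2) by linarith
    then have "z = a" using d(2)[OF z(1)] by force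
    then show ?case using z by (simp add: norm_minus_commute)
  qed
qed

text \<open>Each enumerated family is matched with one alternative of \<open>root\<close>. A
  convergent eigenvalue cannot have real part below \<open>- \<tau> * s / 2\<close> for large
  \<tau>, so it lies near the spectrum of the skew block. An escaping eigenvalue cannot stay near
  that bounded spectrum, so it lies below the threshold.\<close>

lemma penalised_spectrum_decouples:
  fixes K S :: "nat \<Rightarrow> nat \<Rightarrow> real" and nC nN :: nat and \<mu> :: "nat \<Rightarrow> complex"
  defines "M \<equiv> \<lambda>\<tau>. Matrix.mat (nC + nN) (nC + nN) (\<lambda>(i, j). complex_of_real (K i j - \<tau> * S i j))"
  assumes skew: "\<forall>i<nC + nN. \<forall>j<nC + nN. K i j = - K j i"
    and S0: "\<And>i j. i < nC \<or> j < nC \<Longrightarrow> S i j = 0"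
    and pos: "\<And>v. \<exists>i<nN. v i \<noteq> 0 \<Longrightarrow> 0 < (\<Sum>i<nN. \<Sum>j<nN. v i * S (nC + i) (nC + j) * v j)"
    and \<mu>: "proots (char_poly (Matrix.mat nC nC (\<lambda>(i, j). complex_of_real (K i j)))) = image_mset \<mu> (mset_set {..<nC})"
  shows "\<exists>evC evNC :: real \<Rightarrow> nat \<Rightarrow> complex.
    (\<forall>\<^sub>F \<tau> in at_top.
       proots (char_poly (M \<tau>)) =
         image_mset (evC \<tau>) (mset_set {..<nC}) + image_mset (evNC \<tau>) (mset_set {..<nN}) \<and>
       evC \<tau> ` {..<nC} \<inter> evNC \<tau> ` {..<nN} = {}) \<and>
    (\<forall>i<nN. filterlim (\<lambda>\<tau>. Re (evNC \<tau> i)) at_bot at_top \<and>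
             (\<lambda>\<tau>. \<bar>Re (evNC \<tau> i)\<bar>) \<in> O[at_top](\<lambda>\<tau>. \<tau>)) \<and>
    (\<forall>j<nC. (\<lambda>\<tau>. cmod (evC \<tau> j - \<mu> j)) \<in> O[at_top](\<lambda>\<tau>. 1 / \<tau>))"
proof -
  define n where "n = nC + nN"
  define C N where "C = {..<nC}" and "N = {nC..<n}"
  define A where "A = Matrix.mat nC nC (\<lambda>(i, j). complex_of_real (K i j))"
  define T where "T = Matrix.mat nN nN (\<lambda>(i, j). complex_of_real (S (nC + i) (nC + j)))"
  have CN: "C \<union> N = {..<n}" "C \<inter> N = {}" "finite C" "finite N"
    by (auto simp: C_def N_def n_def)
  have carr: "M \<tau> \<in> carrier_mat n n" "A \<in> carrier_mat nC nC" for \<tau>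
    by (simp_all add: M_def A_def n_def)
  have shift: "(\<Sum>i\<in>N. f i) = (\<Sum>i<nN. f (nC + i))" for f :: "nat \<Rightarrow> real"
    using sum.shift_bounds_nat_ivl[of f 0 nC nN]
    by (simp add: N_def n_def atLeast0LessThan add.commute)

  define q where "q v = (\<Sum>i<nN. \<Sum>j<nN. v i * S (nC + i) (nC + j) * v j)" for v
  \<comment> \<open>Compactness of the unit sphere turns pointwise positivity into a uniform
    constant; for \<open>nN = 0\<close> the sphere is empty and any \<open>s\<close> serves.\<close>
  have "\<exists>s>0. \<forall>v. s * (\<Sum>i<nN. (v i)\<^sup>2) \<le> q v"
  proof (cases "nN = 0")
    case True
    then show ?thesis by (intro exI[of _ 1]) (simp add: q_def)
  next
    case False
    have "\<exists>v. (\<Sum>i<nN. (norm (v i))\<^sup>2) = 1 \<and> (\<forall>u. q v * (\<Sum>i<nN. (norm (u i))\<^sup>2) \<le> q u)"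
    proof (rule attains_inf_on_sphere)
      show "continuous_on UNIV q"
        unfolding q_def by (intro continuous_intros continuous_on_product_coordinates)
      show "q (\<lambda>i. c *\<^sub>R u i) = c\<^sup>2 * q u" for c u
        by (simp add: q_def sum_distrib_left power2_eq_square mult_ac)
    qed (use False in \<open>auto simp: q_def\<close>)
    then obtain v where v: "(\<Sum>i<nN. (v i)\<^sup>2) = 1" "\<forall>u. q v * (\<Sum>i<nN. (u i)\<^sup>2) \<le> q u"
      by auto
    have "\<exists>i<nN. v i \<noteq> 0"
    proof (rule ccontr)
      assume "\<not> (\<exists>i<nN. v i \<noteq> 0)"
      then have "(\<Sum>i<nN. (v i)\<^sup>2) = 0" by simp
      then show False using v(1) by simp
    qed
    then have "q v > 0" unfolding q_def by (rule pos)
    then show ?thesis using v(2) by blast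
  qed
  then obtain s where s: "s > 0" "\<forall>v. s * (\<Sum>i<nN. (v i)\<^sup>2) \<le> q v"
    by (elim exE conjE) (rule that)

  have "\<exists>c. \<forall>\<tau>>0. \<forall>l x. (\<exists>i\<in>C \<union> N. x i \<noteq> 0) \<longrightarrow>
    (\<forall>i\<in>C \<union> N. mvec (C \<union> N) (\<lambda>i j. of_real (K i j - \<tau> * S i j)) x i = l * x i) \<longrightarrow>
    Re l < - (\<tau> * s / 2) \<or>
    (\<exists>z w. (\<exists>i\<in>C. w i \<noteq> 0) \<and> (\<forall>i\<in>C. mvec C (\<lambda>i j. of_real (K i j)) w i = z * w i) \<and>
       cmod (z - l) \<le> c / \<tau>)"
  proof (rule penalised_eigenvalue_cases[where K = K and S = S and C = C and N = N and s = s])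
    show "finite C" "finite N" "C \<inter> N = {}" "s > 0" by fact+
    show "\<forall>i\<in>C \<union> N. \<forall>j\<in>C \<union> N. K i j = - K j i"
    proof (intro ballI)
      fix i j assume "i \<in> C \<union> N" "j \<in> C \<union> N"
      then have "i < nC + nN" "j < nC + nN" by (simp_all add: CN(1) n_def)
      then show "K i j = - K j i" using skew by blast
    qed
    show "S i j = 0" if "i \<in> C \<or> j \<in> C" for i j
      using that S0 by (auto simp: C_def)
    show "s * (\<Sum>i\<in>N. (v i)\<^sup>2) \<le> (\<Sum>i\<in>N. \<Sum>j\<in>N. v i * S i j * v j)" for v
      unfolding shift using s(2)[rule_format, of "\<lambda>i. v (nC + i)"] by (simp add: q_def)
  qed
  then obtain c where c: "\<forall>\<tau>>0. \<forall>l x. (\<exists>i\<in>C \<union> N. x i \<noteq> 0) \<longrightarrow>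
    (\<forall>i\<in>C \<union> N. mvec (C \<union> N) (\<lambda>i j. of_real (K i j - \<tau> * S i j)) x i = l * x i) \<longrightarrow>
    Re l < - (\<tau> * s / 2) \<or>
    (\<exists>z w. (\<exists>i\<in>C. w i \<noteq> 0) \<and> (\<forall>i\<in>C. mvec C (\<lambda>i j. of_real (K i j)) w i = z * w i) \<and>
       cmod (z - l) \<le> c / \<tau>)" by (rule exE)

  have root: "Re l < - (\<tau> * s / 2) \<or> (\<exists>z\<in>\<mu> ` {..<nC}. cmod (z - l) \<le> c / \<tau>)"
    and root_le: "cmod l \<le> (\<Sum>i<n. \<Sum>j<n. \<bar>K i j\<bar>) + \<tau> * (\<Sum>i<n. \<Sum>j<n. \<bar>S i j\<bar>)"
    if "l \<in># proots (char_poly (M \<tau>))" "\<tau> > 0" for l \<tau>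
  proof -
    note l = that(1)
    obtain x where "(\<exists>i<n. x i \<noteq> 0) \<and> (\<forall>i<n. (\<Sum>j<n. complex_of_real (K i j - \<tau> * S i j) * x j) = l * x i)"
      using l unfolding M_def n_def[symmetric] char_poly_root_iff by (rule exE)
    then have x: "\<exists>i<n. x i \<noteq> 0" "\<forall>i<n. (\<Sum>j<n. complex_of_real (K i j - \<tau> * S i j) * x j) = l * x i"
      by blast+
    have x1: "\<exists>i\<in>C \<union> N. x i \<noteq> 0" using x(1) by (auto simp: CN(1))
    have x2: "\<forall>i\<in>C \<union> N. mvec (C \<union> N) (\<lambda>i j. of_real (K i j - \<tau> * S i j)) x i = l * x i"
      using x(2) by (simp add: CN(1) mvec_def)
    have "z \<in> \<mu> ` {..<nC}" if "\<exists>i\<in>C. w i \<noteq> 0" "\<forall>i\<in>C. mvec C (\<lambda>i j. of_real (K i j)) w i = z * w i" for z w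
    proof -
      have "z \<in># proots (char_poly A)"
        unfolding A_def char_poly_root_iff using that
        by (intro exI[of _ w]) (auto simp: C_def mvec_def)
      then show ?thesis by (simp add: \<mu> A_def)
    qed
    moreover have "Re l < - (\<tau> * s / 2) \<or>
      (\<exists>z w. (\<exists>i\<in>C. w i \<noteq> 0) \<and> (\<forall>i\<in>C. mvec C (\<lambda>i j. of_real (K i j)) w i = z * w i) \<and>
         cmod (z - l) \<le> c / \<tau>)"
      by (rule c[THEN spec, THEN mp, OF that(2), THEN spec, THEN spec, THEN mp, OF x1, THEN mp, OF x2])
    ultimately show "Re l < - (\<tau> * s / 2) \<or> (\<exists>z\<in>\<mu> ` {..<nC}. cmod (z - l) \<le> c / \<tau>)"
      by (elim disjE exE conjE) auto
    have "cmod l \<le> (\<Sum>i\<in>C \<union> N. \<Sum>j\<in>C \<union> N. cmod (complex_of_real (K i j - \<tau> * S i j)))"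
      by (rule eigenvalue_norm_le[OF _ x1 x2]) (simp add: CN)
    also have "\<dots> \<le> (\<Sum>i<n. \<Sum>j<n. \<bar>K i j\<bar> + \<tau> * \<bar>S i j\<bar>)"
      unfolding CN(1) norm_of_real
    proof (intro sum_mono)
      fix i j
      show "\<bar>K i j - \<tau> * S i j\<bar> \<le> \<bar>K i j\<bar> + \<tau> * \<bar>S i j\<bar>"
        using abs_triangle_ineq4[of "K i j" "\<tau> * S i j"] that(2) by (simp add: abs_mult)
    qed
    also have "\<dots> = (\<Sum>i<n. \<Sum>j<n. \<bar>K i j\<bar>) + \<tau> * (\<Sum>i<n. \<Sum>j<n. \<bar>S i j\<bar>)"
      by (simp add: sum.distrib sum_distrib_left)
    finally show "cmod l \<le> (\<Sum>i<n. \<Sum>j<n. \<bar>K i j\<bar>) + \<tau> * (\<Sum>i<n. \<Sum>j<n. \<bar>S i j\<bar>)" .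
  qed

  define p where "p \<tau> = Polynomial.smult (complex_of_real (1 / \<tau>) ^ nN) (char_poly (M \<tau>))" for \<tau>
  define Q where "Q = Polynomial.smult (Determinant.det T) (char_poly A)"
  have detT: "Determinant.det T \<noteq> 0"
    unfolding T_def by (rule det_pos_def_nonzero) (rule pos)
  have degA: "degree (char_poly A) = nC" "char_poly A \<noteq> 0"
    using degree_monic_char_poly[OF carr(2)] by auto
  have degM: "degree (char_poly (M \<tau>)) = n" "char_poly (M \<tau>) \<noteq> 0" for \<tau>
    using degree_monic_char_poly[OF carr(1)[of \<tau>]] by auto
  have proots_p: "proots (p \<tau>) = proots (char_poly (M \<tau>))" if "\<tau> > 0" for \<tau>
    using that by (simp add: p_def)
  have "\<exists>f. (\<forall>j<nC. ((\<lambda>t. f t j) \<longlongrightarrow> \<mu> j) at_top) \<and>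
    (\<forall>\<^sub>F t in at_top. image_mset (f t) (mset_set {..<nC}) \<subseteq># proots (p t)) \<and>
    (\<forall>R. \<forall>\<^sub>F t in at_top. \<forall>x\<in>#proots (p t) - image_mset (f t) (mset_set {..<nC}). R < cmod x)"
  proof (rule proots_tendsto)
    show "\<forall>\<^sub>F \<tau> in at_top. degree (p \<tau>) \<le> n"
      by (intro always_eventually allI) (metis degM(1) degree_smult_le p_def)
    show "degree Q \<le> n" "Q \<noteq> 0" using degA detT by (simp_all add: Q_def n_def)
    show "proots Q = image_mset \<mu> (mset_set {..<nC})"
      using detT \<mu> by (simp add: Q_def A_def)
    show "((\<lambda>\<tau>. coeff (p \<tau>) k) \<longlongrightarrow> coeff Q k) at_top" for k
      unfolding p_def Q_def M_def A_def T_def by (rule char_poly_penalised_tendsto) (rule S0)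
  qed
  then obtain f where f: "\<forall>j<nC. ((\<lambda>t. f t j) \<longlongrightarrow> \<mu> j) at_top"
    "\<forall>\<^sub>F t in at_top. image_mset (f t) (mset_set {..<nC}) \<subseteq># proots (p t)"
    "\<forall>R. \<forall>\<^sub>F t in at_top. \<forall>x\<in>#proots (p t) - image_mset (f t) (mset_set {..<nC}). R < cmod x"
    by (elim exE conjE) (rule that)
  define rest where "rest \<tau> = proots (char_poly (M \<tau>)) - image_mset (f \<tau>) (mset_set {..<nC})" for \<tau>
  \<comment> \<open>The choice is meaningful once the convergent family is contained in the
    spectrum, for then exactly \<open>nN\<close> eigenvalues remain; earlier values are
    arbitrary.\<close>
  define g where "g \<tau> = (SOME g. image_mset g (mset_set {..<nN}) = rest \<tau>)" for \<tau>
  note pos_ev = eventually_gt_at_top[of "0::real"]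
  have sub: "\<forall>\<^sub>F \<tau> in at_top. image_mset (f \<tau>) (mset_set {..<nC}) \<subseteq># proots (char_poly (M \<tau>))"
    using f(2) pos_ev by eventually_elim (simp add: proots_p)
  have g: "\<forall>\<^sub>F \<tau> in at_top. image_mset (g \<tau>) (mset_set {..<nN}) = rest \<tau>"
    using sub
  proof eventually_elim
    case (elim \<tau>)
    have "size (rest \<tau>) = nN"
      using elim by (simp add: rest_def size_Diff_submset size_proots_complex degM n_def)
    from someI_ex[OF ex_image_mset_lessThan[OF this]] show ?case by (simp add: g_def)
  qed
  have g_root: "\<forall>\<^sub>F \<tau> in at_top. \<forall>i<nN. g \<tau> i \<in># rest \<tau>"
    using g
  proof eventually_elim
    case (elim \<tau>)
    then show ?case by (metis elem_mset_set finite_lessThan image_eqI lessThan_iff set_image_mset)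
  qed
  \<comment> \<open>The radius given to \<open>f(3)\<close> exceeds every
    \<open>cmod (\<mu> j) + c / \<tau>\<close> with \<tau> at least 1, so an eigenvalue beyond it is
    not within \<open>c / \<tau>\<close> of any \<open>\<mu> j\<close>.\<close>
  have g_far: "\<forall>\<^sub>F \<tau> in at_top. \<forall>i<nN. Re (g \<tau> i) < - (\<tau> * s / 2) \<and>
      cmod (g \<tau> i) \<le> (\<Sum>i<n. \<Sum>j<n. \<bar>K i j\<bar>) + \<tau> * (\<Sum>i<n. \<Sum>j<n. \<bar>S i j\<bar>)"
    using g_root f(3)[rule_format, of "(\<Sum>j<nC. cmod (\<mu> j)) + \<bar>c\<bar>"] eventually_ge_at_top[of "1::real"]
  proof eventually_elim
    case (elim \<tau>)
    show ?case
    proof (intro allI impI)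
      fix i assume "i < nN"
      then have i: "g \<tau> i \<in># rest \<tau>" using elim(1) by blast
      then have r: "g \<tau> i \<in># proots (char_poly (M \<tau>))" by (auto simp: rest_def dest: in_diffD)
      have far: "(\<Sum>j<nC. cmod (\<mu> j)) + \<bar>c\<bar> < cmod (g \<tau> i)"
        using elim(2,3) i by (simp add: rest_def proots_p)
      have "\<not> cmod (\<mu> j - g \<tau> i) \<le> c / \<tau>" if "j < nC" for j
      proof
        assume le: "cmod (\<mu> j - g \<tau> i) \<le> c / \<tau>"
        have "c / \<tau> \<le> \<bar>c\<bar> / 1"
          using elim(3) by (intro frac_le) auto
        moreover have "cmod (\<mu> j) \<le> (\<Sum>j<nC. cmod (\<mu> j))"
          using that by (intro member_le_sum) auto
        moreover have "cmod (g \<tau> i) \<le> cmod (\<mu> j) + cmod (\<mu> j - g \<tau> i)"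
          by (metis norm_minus_commute norm_triangle_sub)
        ultimately show False using far le by simp
      qed
      then show "Re (g \<tau> i) < - (\<tau> * s / 2) \<and>
          cmod (g \<tau> i) \<le> (\<Sum>i<n. \<Sum>j<n. \<bar>K i j\<bar>) + \<tau> * (\<Sum>i<n. \<Sum>j<n. \<bar>S i j\<bar>)"
        using root[OF r] root_le[OF r] elim(3) by auto
    qed
  qed
  have f_bd: "\<forall>\<^sub>F \<tau> in at_top. Re (f \<tau> j) \<ge> - (\<tau> * s / 2)" if "j < nC" for j
  proof -
    have "((\<lambda>\<tau>. Re (f \<tau> j)) \<longlongrightarrow> Re (\<mu> j)) at_top"
      using f(1)[rule_format, OF that] by (rule tendsto_Re)
    then have "\<forall>\<^sub>F \<tau> in at_top. Re (f \<tau> j) > Re (\<mu> j) - 1"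
      by (rule order_tendstoD) simp
    \<comment> \<open>Exactly the condition for \<open>- \<tau> * s / 2\<close> to lie at or below
      \<open>Re (\<mu> j) - 1\<close>.\<close>
    moreover have "\<forall>\<^sub>F \<tau> in at_top. \<tau> \<ge> 2 * (1 - Re (\<mu> j)) / s"
      by (rule eventually_ge_at_top)
    ultimately show ?thesis
      by eventually_elim (use s(1) in \<open>simp add: field_simps\<close>)
  qed
  then have f_bd_all: "\<forall>\<^sub>F \<tau> in at_top. \<forall>j\<in>{..<nC}. Re (f \<tau> j) \<ge> - (\<tau> * s / 2)"
    by (intro eventually_ball_finite) auto
  show ?thesis
  proof (rule exI[of _ f], rule exI[of _ g], intro conjI allI impI)
    show "\<forall>\<^sub>F \<tau> in at_top. proots (char_poly (M \<tau>)) =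
         image_mset (f \<tau>) (mset_set {..<nC}) + image_mset (g \<tau>) (mset_set {..<nN}) \<and>
       f \<tau> ` {..<nC} \<inter> g \<tau> ` {..<nN} = {}"
      using sub g g_far f_bd_all
    proof eventually_elim
      case (elim \<tau>)
      \<comment> \<open>The real parts lie on opposite sides of the threshold.\<close>
      have "f \<tau> j \<noteq> g \<tau> i" if "j < nC" "i < nN" for i j
        using elim(3,4) that by force
      then show ?case using elim(1,2) by (auto simp: rest_def)
    qed
  next
    fix i assume i: "i < nN"
    show "filterlim (\<lambda>\<tau>. Re (g \<tau> i)) at_bot at_top"
      unfolding filterlim_at_bot
    proof
      fix Z
      show "\<forall>\<^sub>F \<tau> in at_top. Re (g \<tau> i) \<le> Z"
        using g_far eventually_ge_at_top[of "- 2 * Z / s"]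
      proof eventually_elim
        case (elim \<tau>)
        have "- (\<tau> * s / 2) \<le> Z" using elim(2) s(1) by (simp add: field_simps)
        then show ?case using elim(1) i by force
      qed
    qed
    define k where "k = (\<Sum>i<n. \<Sum>j<n. \<bar>K i j\<bar>)"
    have "k \<ge> 0" by (simp add: k_def sum_nonneg)
    show "(\<lambda>\<tau>. \<bar>Re (g \<tau> i)\<bar>) \<in> O[at_top](\<lambda>\<tau>. \<tau>)"
    proof (rule bigoI[where c = "k + (\<Sum>i<n. \<Sum>j<n. \<bar>S i j\<bar>)"])
      show "\<forall>\<^sub>F \<tau> in at_top. norm \<bar>Re (g \<tau> i)\<bar> \<le> (k + (\<Sum>i<n. \<Sum>j<n. \<bar>S i j\<bar>)) * norm \<tau>"
        using g_far eventually_ge_at_top[of "1::real"]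
      proof eventually_elim
        case (elim \<tau>)
        have "\<bar>Re (g \<tau> i)\<bar> \<le> k + \<tau> * (\<Sum>i<n. \<Sum>j<n. \<bar>S i j\<bar>)"
          using elim(1) i abs_Re_le_cmod[of "g \<tau> i"] unfolding k_def by force
        also have "\<dots> \<le> k * \<tau> + \<tau> * (\<Sum>i<n. \<Sum>j<n. \<bar>S i j\<bar>)"
          using elim(2) \<open>k \<ge> 0\<close> by (simp add: mult_le_cancel_left1)
        finally show ?case using elim(2) by (simp add: algebra_simps)
      qed
    qed
  next
    fix j assume j: "j < nC"
    have "\<forall>\<^sub>F \<tau> in at_top. \<exists>z\<in>\<mu> ` {..<nC}. cmod (z - f \<tau> j) \<le> c / \<tau>"
      using sub f_bd[OF j] pos_ev
    proof eventually_elim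
      case (elim \<tau>)
      have "f \<tau> j \<in># proots (char_poly (M \<tau>))"
        using elim(1) j by (auto intro: mset_subset_eqD)
      then show ?case using root[of "f \<tau> j" \<tau>] elim(2,3) by force
    qed
    then have "\<forall>\<^sub>F \<tau> in at_top. cmod (f \<tau> j - \<mu> j) \<le> c / \<tau>"
      by (rule bound_at_near_of_tendsto[OF f(1)[rule_format, OF j] finite_imageI[OF finite_lessThan]])
    then have "\<forall>\<^sub>F \<tau> in at_top. norm (cmod (f \<tau> j - \<mu> j)) \<le> c * norm (1 / \<tau>)"
      using pos_ev by eventually_elim simp
    then show "(\<lambda>\<tau>. cmod (f \<tau> j - \<mu> j)) \<in> O[at_top](\<lambda>\<tau>. 1 / \<tau>)"
      by (rule bigoI)
  qed
qed

subsection \<open>The discontinuous Galerkin form\<close>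

lemma l2_fun_inner_integrable:
  assumes "l2_fun M f" "l2_fun M g"
  shows "integrable M (\<lambda>x. f x \<bullet> g x)"
proof (rule Bochner_Integration.integrable_bound)
  show "integrable M (\<lambda>x. (norm (f x))\<^sup>2 + (norm (g x))\<^sup>2)"
    using assms by (auto simp: l2_fun_def)
  show "(\<lambda>x. f x \<bullet> g x) \<in> borel_measurable M"
    using assms by (auto simp: l2_fun_def)
  have "norm (a \<bullet> b) \<le> norm ((norm a)\<^sup>2 + (norm b)\<^sup>2)" for a b :: 'b
  proof -
    have "norm (a \<bullet> b) \<le> norm a * norm b" by (simp add: Cauchy_Schwarz_ineq2)
    also have "\<dots> \<le> (norm a)\<^sup>2 + (norm b)\<^sup>2"
      using sum_squares_bound[of "norm a" "norm b"] mult_nonneg_nonneg[OF norm_ge_zero[of a] norm_ge_zero[of b]]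
      by linarith
    finally show ?thesis by simp
  qed
  then show "AE x in M. norm (f x \<bullet> g x) \<le> norm ((norm (f x))\<^sup>2 + (norm (g x))\<^sup>2)" by simp
qed

lemma l2_fun_zero: "l2_fun M (\<lambda>x. 0)"
  by (simp add: l2_fun_def)

lemma l2_fun_add:
  assumes "l2_fun M f" "l2_fun M g"
  shows "l2_fun M (\<lambda>x. f x + g x)"
proof -
  have "integrable M (\<lambda>x. (norm (f x))\<^sup>2 + 2 * (f x \<bullet> g x) + (norm (g x))\<^sup>2)"
    using assms l2_fun_inner_integrable[OF assms] by (auto simp: l2_fun_def)
  moreover have "(norm (a + b))\<^sup>2 = (norm a)\<^sup>2 + 2 * (a \<bullet> b) + (norm b)\<^sup>2" for a b :: 'b
    by (simp add: power2_norm_eq_inner inner_add inner_commute)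
  moreover have "(\<lambda>x. f x + g x) \<in> borel_measurable M"
    using assms by (auto simp: l2_fun_def)
  ultimately show ?thesis by (simp add: l2_fun_def)
qed

lemma l2_fun_bounded_linear:
  fixes f :: "'a \<Rightarrow> 'b::euclidean_space" and L :: "'b \<Rightarrow> 'c::euclidean_space"
  assumes "bounded_linear L" "l2_fun M f"
  shows "l2_fun M (\<lambda>x. L (f x))"
proof -
  have f: "f \<in> borel_measurable M" "integrable M (\<lambda>x. (norm (f x))\<^sup>2)"
    using assms(2) by (auto simp: l2_fun_def)
  obtain K where K: "\<And>x. norm (L x) \<le> norm x * K" "0 < K"
    using bounded_linear.pos_bounded[OF assms(1)] by blast
  have m: "(\<lambda>x. L (f x)) \<in> borel_measurable M"
    using borel_measurable_continuous_onI[OF linear_continuous_on[OF assms(1)]] f(1) by measurable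
  have "integrable M (\<lambda>x. (norm (L (f x)))\<^sup>2)"
  proof (rule Bochner_Integration.integrable_bound)
    show "integrable M (\<lambda>x. (norm (f x))\<^sup>2 * K\<^sup>2)"
      using f(2) by simp
    show "(\<lambda>x. (norm (L (f x)))\<^sup>2) \<in> borel_measurable M"
      using m by measurable
    have "(norm (L y))\<^sup>2 \<le> (norm y)\<^sup>2 * K\<^sup>2" for y
      using power_mono[OF K(1)[of y], of 2] by (simp add: power_mult_distrib)
    then show "AE x in M. norm ((norm (L (f x)))\<^sup>2) \<le> norm ((norm (f x))\<^sup>2 * K\<^sup>2)" by simp
  qed
  with m show ?thesis by (simp add: l2_fun_def)
qed

lemmas l2_fun_scaleR = l2_fun_bounded_linear[OF bounded_linear_scaleR_right]

lemma l2_fun_sum: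
  assumes "\<And>i. i \<in> I \<Longrightarrow> l2_fun M (f i)"
  shows "l2_fun M (\<lambda>x. \<Sum>i\<in>I. f i x)"
  using assms by (induction I rule: infinite_finite_induct) (auto simp: l2_fun_zero l2_fun_add)

lemma l2_fun_finite_measure:
  assumes "finite_measure M" "f \<in> borel_measurable M" "\<And>x. x \<in> space M \<Longrightarrow> norm (f x) \<le> B"
  shows "l2_fun M f"
proof -
  have "integrable M (\<lambda>x. (norm (f x))\<^sup>2)"
    using assms by (intro finite_measure.integrable_const_bound[where B = "B\<^sup>2"] AE_I2) (auto intro!: power_mono)
  then show ?thesis using assms by (simp add: l2_fun_def)
qed

lemma l2_inner_commute: "l2_inner M f g = l2_inner M g f"
  by (simp add: l2_inner_def inner_commute)

lemma l2_inner_sum_left: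
  assumes "\<And>i. i \<in> I \<Longrightarrow> l2_fun M (f i)" "l2_fun M g"
  shows "l2_inner M (\<lambda>x. \<Sum>i\<in>I. c i *\<^sub>R f i x) g = (\<Sum>i\<in>I. c i * l2_inner M (f i) g)"
proof -
  have "integrable M (\<lambda>x. c i * (f i x \<bullet> g x))" if "i \<in> I" for i
    using l2_fun_inner_integrable[OF assms(1)[OF that] assms(2)] by simp
  then show ?thesis
    by (simp add: l2_inner_def inner_sum_left)
qed

lemma l2_inner_sum_sum:
  assumes "\<And>i. i \<in> I \<Longrightarrow> l2_fun M (f i)"
  shows "l2_inner M (\<lambda>x. \<Sum>i\<in>I. c i *\<^sub>R f i x) (\<lambda>x. \<Sum>i\<in>I. c i *\<^sub>R f i x)
    = (\<Sum>i\<in>I. \<Sum>j\<in>I. c i * l2_inner M (f i) (f j) * c j)"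
proof -
  have *: "l2_fun M (\<lambda>x. \<Sum>i\<in>I. c i *\<^sub>R f i x)"
    by (intro l2_fun_sum l2_fun_scaleR assms)
  have "l2_inner M (f i) (\<lambda>x. \<Sum>j\<in>I. c j *\<^sub>R f j x) = (\<Sum>j\<in>I. l2_inner M (f i) (f j) * c j)" if "i \<in> I" for i
    using l2_inner_sum_left[of I M f "f i" c] assms that
    by (simp add: l2_inner_commute[of M "f i"] mult.commute)
  then show ?thesis
    by (simp add: l2_inner_sum_left assms * sum_distrib_left mult.assoc)
qed

lemma l2_inner_eq_0_AE:
  assumes "(AE x in M. f x = 0) \<or> (AE x in M. g x = 0)"
  shows "l2_inner M f g = 0"
  unfolding l2_inner_def using assms by (intro integral_eq_zero_AE) auto

lemma l2_inner_self_eq_0_iff: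
  assumes "l2_fun M f"
  shows "l2_inner M f f = 0 \<longleftrightarrow> (AE x in M. f x = 0)"
  using integral_nonneg_eq_0_iff_AE[of M "\<lambda>x. f x \<bullet> f x"] l2_fun_inner_integrable[OF assms assms]
  by (simp add: l2_inner_def)

lemma l2_inner_self_nonneg: "0 \<le> l2_inner M f f"
  unfolding l2_inner_def by (intro integral_nonneg_AE) simp

section \<open>Polynomials and the surface measure on faces\<close>

lemma poly_fun_le_lincomb:
  assumes "p \<in> poly_fun_le N" "q \<in> poly_fun_le N"
  shows "(\<lambda>x. a * p x + b * q x) \<in> poly_fun_le N"
proof -
  obtain c d where c: "\<And>x. p x = (\<Sum>\<alpha> | (\<Sum>i\<in>UNIV. \<alpha> i) \<le> N. c \<alpha> * (\<Prod>i\<in>UNIV. (x $ i) ^ \<alpha> i))"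
    and d: "\<And>x. q x = (\<Sum>\<alpha> | (\<Sum>i\<in>UNIV. \<alpha> i) \<le> N. d \<alpha> * (\<Prod>i\<in>UNIV. (x $ i) ^ \<alpha> i))"
    using assms unfolding poly_fun_le_def by blast
  show ?thesis unfolding poly_fun_le_def
    by (rule CollectI, intro exI[of _ "\<lambda>\<alpha>. a * c \<alpha> + b * d \<alpha>"])
       (simp add: c d sum_distrib_left sum.distrib algebra_simps)
qed

lemma poly_fun_le_continuous:
  assumes "p \<in> poly_fun_le N"
  shows "continuous_on S p"
proof -
  obtain c where c: "p = (\<lambda>x. \<Sum>\<alpha> | (\<Sum>i\<in>UNIV. \<alpha> i) \<le> N. c \<alpha> * (\<Prod>i\<in>UNIV. (x $ i) ^ \<alpha> i))"
    using assms unfolding poly_fun_le_def by blast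
  show ?thesis unfolding c by (intro continuous_intros)
qed

lemma sets_face_measure: "sets (face_measure n F) = sets (restrict_space borel F)"
  by (simp add: face_measure_def)

lemma space_face_measure: "space (face_measure n F) = F"
  by (simp add: face_measure_def space_restrict_space)

text \<open>The prism over a compact face is compact and so has finite volume. The projection
  \<open>closest_point F\<close> is continuous for a nonempty closed convex set, and its
  push-forward preserves the total mass.\<close>

lemma finite_face_measure:
  fixes F :: "(real^'d) set"
  assumes "compact F" "convex F" "F \<noteq> {}"
  shows "finite_measure (face_measure n F)"
proof -
  define P where "P = (\<lambda>(y, t). y + t *\<^sub>R n) ` (F \<times> {0..1})"
  have "compact P"
    unfolding P_def case_prod_beta
    by (intro compact_continuous_image compact_Times assms compact_Icc continuous_intros)
  interpret finite_measure "restrict_space lborel P"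
  proof
    have "emeasure lborel P < \<infinity>"
      using \<open>compact P\<close> by (intro emeasure_bounded_finite compact_imp_bounded)
    then show "emeasure (restrict_space lborel P) (space (restrict_space lborel P)) \<noteq> \<infinity>"
      using \<open>compact P\<close> by (simp add: emeasure_restrict_space space_restrict_space borel_compact)
  qed
  have "closest_point F \<in> measurable (restrict_space lborel P) (restrict_space borel F)"
  proof (intro measurable_restrict_space2 measurable_restrict_space1)
    have "closest_point F \<in> borel_measurable borel"
      using assms by (intro borel_measurable_continuous_onI continuous_on_closest_point compact_imp_closed)
    then show "closest_point F \<in> borel_measurable lborel" by simp
    show "closest_point F \<in> space (restrict_space lborel P) \<rightarrow> F"
      using assms by (auto intro!: closest_point_in_set compact_imp_closed)
  qed
  then show ?thesis
    unfolding face_measure_def P_def[symmetric] by (rule finite_measure_distr)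
qed

text \<open>Agreement on \<open>F\<close> is the right hypothesis because \<open>F\<close> is the
  whole space of the face measure; traces are known to be polynomial only on their element.\<close>

lemma l2_fun_face_continuous:
  fixes F :: "(real^'d) set" and f :: "real^'d \<Rightarrow> 'b::euclidean_space"
  assumes "compact F" "convex F" "F \<noteq> {}" "continuous_on UNIV g" "\<And>x. x \<in> F \<Longrightarrow> f x = g x"
  shows "l2_fun (face_measure n F) f"
proof -
  have "bounded (g ` F)"
    using assms by (intro compact_imp_bounded compact_continuous_image) (auto intro: continuous_on_subset)
  then obtain B where B: "\<And>x. x \<in> F \<Longrightarrow> norm (g x) \<le> B"
    by (auto simp: bounded_iff)
  have "g \<in> borel_measurable (restrict_space borel F)"
    using assms by (intro measurable_restrict_space1 borel_measurable_continuous_onI)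
  then have "g \<in> borel_measurable (face_measure n F)"
    using measurable_cong_sets[OF sets_face_measure refl] by blast
  then have "f \<in> borel_measurable (face_measure n F)"
    using assms(5) by (subst measurable_cong[of _ _ g]) (auto simp: space_face_measure)
  then show ?thesis
    using finite_face_measure[OF assms(1-3)] B assms(5)
    by (intro l2_fun_finite_measure) (auto simp: space_face_measure)
qed

lemma dg_space_lincomb:
  assumes "U \<in> dg_space G" "W \<in> dg_space G"
  shows "(\<lambda>x. a *\<^sub>R U x + b *\<^sub>R W x) \<in> dg_space G"
proof -
  have "\<exists>p. (\<forall>j. (\<lambda>x. p x $ j) \<in> poly_fun_le (dg_degree G)) \<and>
      (\<forall>x\<in>interior D. a *\<^sub>R U x + b *\<^sub>R W x = p x)" if D: "D \<in> dg_mesh G" for D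
  proof -
    obtain p q where "\<forall>j. (\<lambda>x. p x $ j) \<in> poly_fun_le (dg_degree G)" "\<forall>x\<in>interior D. U x = p x"
      "\<forall>j. (\<lambda>x. q x $ j) \<in> poly_fun_le (dg_degree G)" "\<forall>x\<in>interior D. W x = q x"
      using assms D unfolding dg_space_def by blast
    then show ?thesis
      by (intro exI[of _ "\<lambda>x. a *\<^sub>R p x + b *\<^sub>R q x"]) (auto intro!: poly_fun_le_lincomb)
  qed
  then show ?thesis
    using assms by (auto simp: dg_space_def intro!: l2_fun_add l2_fun_scaleR)
qed

lemma dg_space_zero: "(\<lambda>x. 0) \<in> dg_space G"
proof -
  have "(\<lambda>x. 0) \<in> poly_fun_le N" for N :: nat
    unfolding poly_fun_le_def by (rule CollectI, rule exI[of _ "\<lambda>\<alpha>. 0"]) simp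
  then show ?thesis
    by (auto simp: dg_space_def l2_fun_zero intro!: exI[of _ "\<lambda>x. 0"])
qed

section \<open>Traces and normal jumps on a mesh\<close>

context
  fixes G :: "('d::finite, 'm::finite) dg_problem"
  assumes setting: "dg_setting G"
begin

lemma element_polytope:
  assumes "D \<in> dg_mesh G"
  shows "polytope D" "interior D \<noteq> {}"
  using assms setting by (auto simp: dg_setting_def mesh_of_def)

lemma facet_of_element:
  assumes "D \<in> dg_mesh G" "F facet_of D"
  shows "compact F" "convex F" "F \<noteq> {}" "F \<subseteq> D"
proof -
  have "polytope F"
    using assms element_polytope face_of_polytope_polytope facet_of_imp_face_of by blast
  then show "compact F" "convex F"
    by (auto intro: polytope_imp_compact polytope_imp_convex)
  show "F \<noteq> {}" "F \<subseteq> D"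
    using assms by (auto simp: facet_of_def dest: face_of_imp_subset)
qed

text \<open>A convex set with nonempty interior lies in the closure of that interior. The limit
  defining a trace is therefore unique at every point of the element, including corners.\<close>

lemma at_within_element_interior:
  assumes "D \<in> dg_mesh G" "x \<in> D"
  shows "at x within interior D \<noteq> bot"
proof -
  have "x \<in> closure (interior D)"
    using convex_closure_interior[of D] element_polytope[OF assms(1)] assms(2) closure_subset[of D]
    by (auto intro: polytope_imp_convex)
  then have "x islimpt interior D"
    using interior_limit_point[of x "interior D"] by (auto simp: closure_def)
  then show ?thesis by (simp add: trivial_limit_within)
qed

text \<open>The element polynomial is continuous everywhere, so it supplies the limit from inside.
  The limit is part of the conclusion because linear combinations of traces are treated by limit
  rules.\<close>

lemma dg_space_trace:
  assumes "U \<in> dg_space G" "D \<in> dg_mesh G"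
  shows "\<exists>p. continuous_on UNIV p \<and> (\<forall>x\<in>D. trace_from D U x = p x \<and> (U \<longlongrightarrow> p x) (at x within interior D))"
proof -
  obtain p where p: "\<And>j. (\<lambda>x. p x $ j) \<in> poly_fun_le (dg_degree G)" "\<And>x. x \<in> interior D \<Longrightarrow> U x = p x"
    using assms unfolding dg_space_def by blast
  have "continuous_on UNIV (\<lambda>x. \<chi> j. p x $ j)"
    by (intro continuous_on_vec_lambda poly_fun_le_continuous[OF p(1)])
  then have cont: "continuous_on UNIV p" by simp
  have lim: "(U \<longlongrightarrow> p x) (at x within interior D)" for x
  proof -
    have "(p \<longlongrightarrow> p x) (at x within interior D)"
      using cont by (metis continuous_on_def UNIV_I tendsto_within_subset subset_UNIV)
    then show ?thesis
      by (rule Lim_transform_within[where d = 1]) (simp_all add: p)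
  qed
  moreover have "trace_from D U x = p x" if "x \<in> D" for x
    unfolding trace_from_def using lim at_within_element_interior[OF assms(2) that] by (intro tendsto_Lim)
  ultimately show ?thesis using cont by blast
qed

lemma trace_from_lincomb:
  assumes "U \<in> dg_space G" "W \<in> dg_space G" "D \<in> dg_mesh G" "x \<in> D"
  shows "trace_from D (\<lambda>x. a *\<^sub>R U x + b *\<^sub>R W x) x = a *\<^sub>R trace_from D U x + b *\<^sub>R trace_from D W x"
proof -
  have *: "(V \<longlongrightarrow> trace_from D V x) (at x within interior D)" if "V \<in> dg_space G" for V
    using dg_space_trace[OF that assms(3)] assms(4) by force
  have "((\<lambda>x. a *\<^sub>R U x + b *\<^sub>R W x) \<longlongrightarrow> a *\<^sub>R trace_from D U x + b *\<^sub>R trace_from D W x) (at x within interior D)"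
    by (intro tendsto_intros * assms)
  then show ?thesis
    using at_within_element_interior[OF assms(3,4)]
    by (subst trace_from_def) (intro tendsto_Lim)
qed

lemma l2_fun_trace:
  assumes "U \<in> dg_space G" "D \<in> dg_mesh G" "compact F" "convex F" "F \<noteq> {}" "(+) t ` F \<subseteq> D"
  shows "l2_fun (face_measure n F) (\<lambda>x. trace_from D U (t + x))"
proof -
  obtain p where "continuous_on UNIV p" "\<forall>x\<in>D. trace_from D U x = p x"
    using dg_space_trace[OF assms(1,2)] by blast
  then show ?thesis
    using assms(3-6)
    by (intro l2_fun_face_continuous[where g = "\<lambda>x. p (t + x)"])
       (auto intro!: continuous_on_compose2[of UNIV p] continuous_intros)
qed

text \<open>Interior and periodic faces are treated alike: an interior face is the case of the
  neighbouring element with translation 0.\<close>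

lemma exterior_trace_cases:
  assumes "D \<in> dg_mesh G" "F facet_of D"
  obtains (element) D' t where "D' \<in> dg_mesh G" "(+) t ` F \<subseteq> D'"
      "\<And>U x. exterior_trace G D F U x = trace_from D' U (t + x)"
    | (boundary) B where "F \<subseteq> frontier (dg_domain G)" "dg_bc G D F = Exterior B"
      "\<And>U x. exterior_trace G D F U x = B U x"
proof (cases "F \<subseteq> frontier (dg_domain G)")
  case True
  show ?thesis
  proof (cases "dg_bc G D F")
    case (Periodic D' t)
    have "bc_ok G D F" using assms True setting by (simp add: dg_setting_def)
    then have "D' \<in> dg_mesh G" "(+) t ` F facet_of D'"
      by (auto simp: bc_ok_def Periodic)
    then show ?thesis
      using True Periodic facet_of_element(4) by (intro element) (auto simp: exterior_trace_def)
  next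
    case (Exterior B)
    then show ?thesis using True by (intro boundary) (auto simp: exterior_trace_def)
  qed
next
  case False
  have "\<forall>D\<in>dg_mesh G. \<forall>F. F facet_of D \<longrightarrow> F \<subseteq> frontier (dg_domain G) \<or>
      rel_interior F \<subseteq> dg_domain G \<and> (\<exists>!D'. D' \<in> dg_mesh G \<and> D' \<noteq> D \<and> F facet_of D')"
    using setting by (simp add: dg_setting_def mesh_of_def)
  from this[rule_format, OF assms] False
  have "\<exists>!D'. D' \<in> dg_mesh G \<and> D' \<noteq> D \<and> F facet_of D'"
    by simp
  from theI'[OF this, folded neighbour_def] show ?thesis
    using False facet_of_element(4)[of "neighbour G D F" F]
    by (intro element[of "neighbour G D F" 0]) (auto simp: exterior_trace_def)
qed

lemma bc_ok_exterior:
  assumes "D \<in> dg_mesh G" "F facet_of D" "F \<subseteq> frontier (dg_domain G)" "dg_bc G D F = Exterior B"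
  shows "U \<in> dg_space G \<Longrightarrow> l2_fun (face_measure (outward_normal D F) F) (B U)"
    and "U \<in> dg_space G \<Longrightarrow> W \<in> dg_space G \<Longrightarrow>
      AE x in face_measure (outward_normal D F) F.
        B (\<lambda>x. a *\<^sub>R U x + b *\<^sub>R W x) x = a *\<^sub>R B U x + b *\<^sub>R B W x"
proof -
  have "bc_ok G D F" using assms setting by (simp add: dg_setting_def)
  then have l2: "\<forall>U\<in>dg_space G. l2_fun (face_measure (outward_normal D F) F) (B U)"
    and lin: "\<forall>U\<in>dg_space G. \<forall>W\<in>dg_space G. \<forall>Z\<in>dg_space G. \<forall>a b.
      (AE x in lebesgue_on (dg_domain G). Z x = a *\<^sub>R U x + b *\<^sub>R W x) \<longrightarrow>
      (AE x in face_measure (outward_normal D F) F. B Z x = a *\<^sub>R B U x + b *\<^sub>R B W x)"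
    by (simp_all add: bc_ok_def assms(4))
  show "l2_fun (face_measure (outward_normal D F) F) (B U)" if "U \<in> dg_space G"
    using l2 that by blast
  show "AE x in face_measure (outward_normal D F) F.
      B (\<lambda>x. a *\<^sub>R U x + b *\<^sub>R W x) x = a *\<^sub>R B U x + b *\<^sub>R B W x"
    if "U \<in> dg_space G" "W \<in> dg_space G"
    by (rule lin[rule_format, OF that dg_space_lincomb[OF that]]) simp
qed

lemma normal_jump_l2:
  assumes "D \<in> dg_mesh G" "F facet_of D" "U \<in> dg_space G"
  shows "l2_fun (face_measure (outward_normal D F) F) (normal_jump G D F U)"
proof -
  note F = facet_of_element[OF assms(1,2)]
  have ext: "l2_fun (face_measure (outward_normal D F) F) (exterior_trace G D F U)"
    using assms(1,2)
  proof (cases rule: exterior_trace_cases)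
    case (element D' t)
    then show ?thesis
      using l2_fun_trace[OF assms(3) element(1) F(1-3) element(2)] by (simp add: element(3)[abs_def])
  next
    case (boundary B)
    then show ?thesis
      using bc_ok_exterior(1)[OF assms(1,2) boundary(1,2) assms(3)] by (simp add: boundary(3)[abs_def])
  qed
  have tr: "l2_fun (face_measure (outward_normal D F) F) (trace_from D U)"
    using l2_fun_trace[OF assms(3,1) F(1-3), of 0] F(4) by simp
  have "l2_fun (face_measure (outward_normal D F) F)
      (\<lambda>x. exterior_trace G D F U x + (-1) *\<^sub>R trace_from D U x)"
    by (intro l2_fun_add l2_fun_scaleR ext tr)
  then show ?thesis
    unfolding normal_jump_def[abs_def] jump_def
    by (intro l2_fun_bounded_linear[OF linear_conv_bounded_linear[THEN iffD1, OF matrix_vector_mul_linear]]) simp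
qed

text \<open>Traces combine linearly at every point of the face, but an exterior boundary map only
  almost everywhere, so the identity is stated in that form.\<close>

lemma normal_jump_lincomb:
  assumes "D \<in> dg_mesh G" "F facet_of D" "U \<in> dg_space G" "W \<in> dg_space G"
  shows "AE x in face_measure (outward_normal D F) F.
    normal_jump G D F (\<lambda>x. a *\<^sub>R U x + b *\<^sub>R W x) x = a *\<^sub>R normal_jump G D F U x + b *\<^sub>R normal_jump G D F W x"
proof -
  note F = facet_of_element[OF assms(1,2)]
  have "AE x in face_measure (outward_normal D F) F.
    exterior_trace G D F (\<lambda>x. a *\<^sub>R U x + b *\<^sub>R W x) x = a *\<^sub>R exterior_trace G D F U x + b *\<^sub>R exterior_trace G D F W x"
    using assms(1,2)
  proof (cases rule: exterior_trace_cases)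
    case (element D' t)
    then show ?thesis
      by (intro AE_I2) (auto simp: space_face_measure intro!: trace_from_lincomb assms)
  next
    case (boundary B)
    then show ?thesis
      using bc_ok_exterior(2)[OF assms(1,2) boundary(1,2) assms(3,4)] by simp
  qed
  moreover have "AE x in face_measure (outward_normal D F) F.
    trace_from D (\<lambda>x. a *\<^sub>R U x + b *\<^sub>R W x) x = a *\<^sub>R trace_from D U x + b *\<^sub>R trace_from D W x"
    using F(4) by (intro AE_I2) (auto simp: space_face_measure intro!: trace_from_lincomb assms)
  ultimately show ?thesis
  proof eventually_elim
    case (elim x)
    have "exterior_trace G D F (\<lambda>x. a *\<^sub>R U x + b *\<^sub>R W x) x - trace_from D (\<lambda>x. a *\<^sub>R U x + b *\<^sub>R W x) x
      = a *\<^sub>R (exterior_trace G D F U x - trace_from D U x) + b *\<^sub>R (exterior_trace G D F W x - trace_from D W x)"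
      unfolding elim by (simp add: algebra_simps)
    then show ?case
      by (simp add: normal_jump_def jump_def matrix_vector_right_distrib matrix_vector_mult_scaleR)
  qed
qed

text \<open>Membership in the space and linearity are proved together, since splitting off a summand
  requires the partial sum to lie in the space.\<close>

lemma normal_jump_sum:
  fixes n :: nat
  assumes "\<forall>i<n. \<psi> i \<in> dg_space G"
  shows "(\<lambda>x. \<Sum>i<n. c i *\<^sub>R \<psi> i x) \<in> dg_space G \<and>
    (\<forall>D\<in>dg_mesh G. \<forall>F. F facet_of D \<longrightarrow> (AE x in face_measure (outward_normal D F) F.
       normal_jump G D F (\<lambda>x. \<Sum>i<n. c i *\<^sub>R \<psi> i x) x = (\<Sum>i<n. c i *\<^sub>R normal_jump G D F (\<psi> i) x)))"
  using assms
proof (induction n)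
  case 0
  \<comment> \<open>An exterior boundary map need not send the zero function to zero at every point;
    linearity with both coefficients 0 gives a zero jump almost everywhere.\<close>
  then show ?case
    using dg_space_zero normal_jump_lincomb[OF _ _ dg_space_zero dg_space_zero, of _ _ 0 0] by simp
next
  case (Suc n)
  define U where "U x = (\<Sum>i<n. c i *\<^sub>R \<psi> i x)" for x
  have U: "U \<in> dg_space G"
    and AE: "D \<in> dg_mesh G \<Longrightarrow> F facet_of D \<Longrightarrow> AE x in face_measure (outward_normal D F) F.
       normal_jump G D F U x = (\<Sum>i<n. c i *\<^sub>R normal_jump G D F (\<psi> i) x)" for D F
    using Suc by (auto simp: U_def[abs_def])
  have sum: "(\<lambda>x. \<Sum>i<Suc n. c i *\<^sub>R \<psi> i x) = (\<lambda>x. 1 *\<^sub>R U x + c n *\<^sub>R \<psi> n x)"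
    by (simp add: U_def)
  have psi: "\<psi> n \<in> dg_space G" using Suc.prems by simp
  show ?case unfolding sum
  proof (intro conjI ballI allI impI dg_space_lincomb U psi)
    fix D F assume DF: "D \<in> dg_mesh G" "F facet_of D"
    show "AE x in face_measure (outward_normal D F) F.
       normal_jump G D F (\<lambda>x. 1 *\<^sub>R U x + c n *\<^sub>R \<psi> n x) x = (\<Sum>i<Suc n. c i *\<^sub>R normal_jump G D F (\<psi> i) x)"
      using AE[OF DF] normal_jump_lincomb[OF DF U psi, of 1 "c n"]
      by eventually_elim simp
  qed
qed

end

section \<open>Skew-symmetry of the form and definiteness of the penalty\<close>

definition penalty_form :: "('d::finite, 'm::finite) dg_problem \<Rightarrow>
    (real^'d \<Rightarrow> real^'m) \<Rightarrow> (real^'d \<Rightarrow> real^'m) \<Rightarrow> real" where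
  "penalty_form G U W =
     (\<Sum>D\<in>dg_mesh G. 1/4 * face_inner D (\<lambda>F. normal_jump G D F U) (\<lambda>F. normal_jump G D F W))"

lemma dg_form_split: "dg_form G \<tau> U W = dg_form G 0 U W - \<tau> * penalty_form G U W"
  by (simp add: dg_form_def penalty_form_def sum_distrib_left)

lemma face_inner_commute: "face_inner D f g = face_inner D g f"
  by (simp add: face_inner_def l2_inner_commute)

lemma face_inner_conforming:
  assumes "U \<in> conforming_space G" "D \<in> dg_mesh G"
  shows "face_inner D (\<lambda>F. normal_jump G D F U) g = 0"
    and "face_inner D g (\<lambda>F. normal_jump G D F U) = 0"
proof -
  show "face_inner D (\<lambda>F. normal_jump G D F U) g = 0"
    unfolding face_inner_def using assms
    by (intro sum.neutral ballI l2_inner_eq_0_AE disjI1) (auto simp: conforming_space_def)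
  then show "face_inner D g (\<lambda>F. normal_jump G D F U) = 0"
    by (simp add: face_inner_commute)
qed

lemma penalty_form_conforming:
  assumes "U \<in> conforming_space G \<or> W \<in> conforming_space G"
  shows "penalty_form G U W = 0"
  unfolding penalty_form_def using assms by (intro sum.neutral) (auto simp: face_inner_conforming)

lemma dg_form_conforming:
  assumes "U \<in> conforming_space G" "W \<in> conforming_space G"
  shows "dg_form G \<tau> U W = volume_form G U W"
  unfolding dg_form_def using assms by (simp add: face_inner_conforming)

text \<open>The form is already antisymmetrised, so no integration by parts occurs: symmetry of the
  coefficient matrices exchanges its two terms. The exchange is an identity of integrands and so
  holds for arbitrary functions.\<close>

lemma volume_form_skew:
  fixes G :: "('d::finite, 'm::finite) dg_problem"
  assumes "\<And>i. transpose (dg_coeff G i) = dg_coeff G i"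
  shows "volume_form G U W = - volume_form G W U"
proof -
  have "(dg_coeff G i *v a) \<bullet> b = (dg_coeff G i *v b) \<bullet> a" for i and a b :: "real^'m"
    using dot_lmul_matrix[of b "dg_coeff G i" a] assms[of i]
    by (metis inner_commute transpose_matrix_vector)
  then have sym: "l2_inner M (\<lambda>x. dg_coeff G i *v f x) g = l2_inner M (\<lambda>x. dg_coeff G i *v g x) f"
    for i and M :: "(real^'d) measure" and f g :: "real^'d \<Rightarrow> real^'m"
    by (simp add: l2_inner_def)
  show ?thesis
    unfolding volume_form_def sum_negf[symmetric]
  proof (intro sum.cong refl)
    fix D
    have "(\<Sum>i\<in>UNIV. l2_inner (lebesgue_on D) (\<lambda>x. dg_coeff G i *v U x) (partial_deriv i W) -
        l2_inner (lebesgue_on D) (\<lambda>x. dg_coeff G i *v partial_deriv i U x) W) =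
      - (\<Sum>i\<in>UNIV. l2_inner (lebesgue_on D) (\<lambda>x. dg_coeff G i *v W x) (partial_deriv i U) -
        l2_inner (lebesgue_on D) (\<lambda>x. dg_coeff G i *v partial_deriv i W x) U)"
      unfolding sum_negf[symmetric]
      by (intro sum.cong refl) (simp add: sym[of _ _ U] sym[of _ _ "partial_deriv _ U"])
    then show "1/2 * (\<Sum>i\<in>UNIV. l2_inner (lebesgue_on D) (\<lambda>x. dg_coeff G i *v U x) (partial_deriv i W) -
        l2_inner (lebesgue_on D) (\<lambda>x. dg_coeff G i *v partial_deriv i U x) W) =
      - (1/2 * (\<Sum>i\<in>UNIV. l2_inner (lebesgue_on D) (\<lambda>x. dg_coeff G i *v W x) (partial_deriv i U) -
        l2_inner (lebesgue_on D) (\<lambda>x. dg_coeff G i *v partial_deriv i W x) U))"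
      by simp
  qed
qed

lemma dg_form_skew:
  fixes G :: "('d::finite, 'm::finite) dg_problem"
  assumes "\<And>i. transpose (dg_coeff G i) = dg_coeff G i"
  shows "dg_form G 0 U W = - dg_form G 0 W U"
proof -
  have "(\<Sum>D\<in>dg_mesh G. 1/4 *
          (face_inner D (\<lambda>F. average G D F U) (\<lambda>F. normal_jump G D F W) -
           face_inner D (\<lambda>F. normal_jump G D F U) (\<lambda>F. average G D F W))) =
       - (\<Sum>D\<in>dg_mesh G. 1/4 *
          (face_inner D (\<lambda>F. average G D F W) (\<lambda>F. normal_jump G D F U) -
           face_inner D (\<lambda>F. normal_jump G D F W) (\<lambda>F. average G D F U)))"
    unfolding sum_negf[symmetric]
  proof (intro sum.cong refl)
    fix D
    have comm: "face_inner D (\<lambda>F. average G D F U) (\<lambda>F. normal_jump G D F W) =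
        face_inner D (\<lambda>F. normal_jump G D F W) (\<lambda>F. average G D F U)"
      "face_inner D (\<lambda>F. normal_jump G D F U) (\<lambda>F. average G D F W) =
        face_inner D (\<lambda>F. average G D F W) (\<lambda>F. normal_jump G D F U)"
      by (rule face_inner_commute)+
    have arith: "1/4 * (a - b) = - (1/4 * (b - a))" for a b :: real by (simp add: diff_divide_distrib)
    show "1/4 * (face_inner D (\<lambda>F. average G D F U) (\<lambda>F. normal_jump G D F W) -
           face_inner D (\<lambda>F. normal_jump G D F U) (\<lambda>F. average G D F W)) =
       - (1/4 * (face_inner D (\<lambda>F. average G D F W) (\<lambda>F. normal_jump G D F U) -
           face_inner D (\<lambda>F. normal_jump G D F W) (\<lambda>F. average G D F U)))"
      unfolding comm by (rule arith)
  qed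
  then show ?thesis
    using volume_form_skew[OF assms, of U W] by (simp add: dg_form_def)
qed


lemma sum_swap3:
  "(\<Sum>i\<in>I. \<Sum>j\<in>J. \<Sum>a\<in>A. f i j a) = (\<Sum>a\<in>A. \<Sum>i\<in>I. \<Sum>j\<in>J. f i j a)"
proof -
  have "(\<Sum>i\<in>I. \<Sum>j\<in>J. \<Sum>a\<in>A. f i j a) = (\<Sum>i\<in>I. \<Sum>a\<in>A. \<Sum>j\<in>J. f i j a)"
    by (intro sum.cong refl) (rule sum.swap)
  also have "\<dots> = (\<Sum>a\<in>A. \<Sum>i\<in>I. \<Sum>j\<in>J. f i j a)"
    by (rule sum.swap)
  finally show ?thesis .
qed

text \<open>Up to the factor 1/4 the quadratic form is a sum over faces of squared norms of the
  combined normal jump. If it vanishes, every summand vanishes, and linearity almost everywhere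
  identifies the combined jump with the jump of the combination.\<close>

lemma penalty_form_sum_nonneg:
  fixes G :: "('d::finite, 'm::finite) dg_problem" and n :: nat
  assumes "dg_setting G" "\<forall>i<n. \<psi> i \<in> dg_space G"
  shows "(\<Sum>i<n. \<Sum>j<n. v i * penalty_form G (\<psi> j) (\<psi> i) * v j) \<ge> 0"
    and "(\<Sum>i<n. \<Sum>j<n. v i * penalty_form G (\<psi> j) (\<psi> i) * v j) = 0 \<Longrightarrow>
      (\<lambda>x. \<Sum>i<n. v i *\<^sub>R \<psi> i x) \<in> conforming_space G"
proof -
  \<comment> \<open>Built from the combination of the jumps, so that its expansion into pairings is
    exact; the jump of the combination agrees with it only almost everywhere and enters at the
    end.\<close>
  define q where "q D F = l2_inner (face_measure (outward_normal D F) F)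
    (\<lambda>x. \<Sum>i<n. v i *\<^sub>R normal_jump G D F (\<psi> i) x) (\<lambda>x. \<Sum>i<n. v i *\<^sub>R normal_jump G D F (\<psi> i) x)" for D F
  have q: "q D F = (\<Sum>i<n. \<Sum>j<n. v i * l2_inner (face_measure (outward_normal D F) F)
      (normal_jump G D F (\<psi> j)) (normal_jump G D F (\<psi> i)) * v j)" if "D \<in> dg_mesh G" "F facet_of D" for D F
    unfolding q_def using that assms
    by (subst l2_inner_sum_sum) (auto intro!: normal_jump_l2 simp: l2_inner_commute)
  have "(\<Sum>i<n. \<Sum>j<n. v i * penalty_form G (\<psi> j) (\<psi> i) * v j) =
    (\<Sum>i<n. \<Sum>j<n. \<Sum>D\<in>dg_mesh G. \<Sum>F | F facet_of D. 1/4 * (v i * l2_inner (face_measure (outward_normal D F) F)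
      (normal_jump G D F (\<psi> j)) (normal_jump G D F (\<psi> i)) * v j))"
    by (simp add: penalty_form_def face_inner_def sum_distrib_left sum_distrib_right)
  also have "\<dots> = (\<Sum>D\<in>dg_mesh G. \<Sum>F | F facet_of D. \<Sum>i<n. \<Sum>j<n. 1/4 * (v i * l2_inner (face_measure (outward_normal D F) F)
      (normal_jump G D F (\<psi> j)) (normal_jump G D F (\<psi> i)) * v j))"
    unfolding sum_swap3[where A = "dg_mesh G"]
    by (intro sum.cong refl) (rule sum_swap3)
  also have "\<dots> = (\<Sum>D\<in>dg_mesh G. \<Sum>F | F facet_of D. 1/4 * q D F)"
    by (intro sum.cong refl) (simp add: q sum_distrib_left)
  finally have eq: "(\<Sum>i<n. \<Sum>j<n. v i * penalty_form G (\<psi> j) (\<psi> i) * v j) =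
    (\<Sum>D\<in>dg_mesh G. \<Sum>F | F facet_of D. 1/4 * q D F)" .
  have nn: "q D F \<ge> 0" for D F unfolding q_def by (rule l2_inner_self_nonneg)
  show "(\<Sum>i<n. \<Sum>j<n. v i * penalty_form G (\<psi> j) (\<psi> i) * v j) \<ge> 0"
    unfolding eq by (intro sum_nonneg mult_nonneg_nonneg nn) auto
  assume 0: "(\<Sum>i<n. \<Sum>j<n. v i * penalty_form G (\<psi> j) (\<psi> i) * v j) = 0"
  have fin: "finite (dg_mesh G)"
    using assms(1) by (simp add: dg_setting_def mesh_of_def)
  have finF: "finite {F. F facet_of D}" if "D \<in> dg_mesh G" for D
    using element_polytope(1)[OF assms(1) that] by (rule finite_polytope_facets)
  have "(\<Sum>F | F facet_of D. 1/4 * q D F) = 0" if "D \<in> dg_mesh G" for D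
    using 0 that fin unfolding eq by (subst (asm) sum_nonneg_eq_0_iff) (auto intro!: sum_nonneg simp: nn)
  then have q0: "q D F = 0" if "D \<in> dg_mesh G" "F facet_of D" for D F
    using that finF[OF that(1)] nn by (force simp: sum_nonneg_eq_0_iff)
  note U = normal_jump_sum[where n = n and \<psi> = \<psi> and c = v, OF assms]
  have "AE x in face_measure (outward_normal D F) F. normal_jump G D F (\<lambda>x. \<Sum>i<n. v i *\<^sub>R \<psi> i x) x = 0"
    if "D \<in> dg_mesh G" "F facet_of D" for D F
  proof -
    have "l2_fun (face_measure (outward_normal D F) F) (\<lambda>x. \<Sum>i<n. v i *\<^sub>R normal_jump G D F (\<psi> i) x)"
      using that assms by (intro l2_fun_sum l2_fun_scaleR normal_jump_l2) auto
    then have "AE x in face_measure (outward_normal D F) F. (\<Sum>i<n. v i *\<^sub>R normal_jump G D F (\<psi> i) x) = 0"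
      using q0[OF that] by (simp add: q_def l2_inner_self_eq_0_iff)
    moreover have "AE x in face_measure (outward_normal D F) F. normal_jump G D F (\<lambda>x. \<Sum>i<n. v i *\<^sub>R \<psi> i x) x
        = (\<Sum>i<n. v i *\<^sub>R normal_jump G D F (\<psi> i) x)"
      by (rule U[THEN conjunct2, rule_format, OF that])
    ultimately show ?thesis by eventually_elim simp
  qed
  then show "(\<lambda>x. \<Sum>i<n. v i *\<^sub>R \<psi> i x) \<in> conforming_space G"
    using U by (simp add: conforming_space_def)
qed

lemma penalty_form_pos:
  fixes G :: "('d::finite, 'm::finite) dg_problem" and n :: nat
  assumes "dg_setting G"
    and "l2_orthonormal_basis (lebesgue_on (dg_domain G)) (nonconforming_space G) n \<psi>"
    and "\<exists>i<n. v i \<noteq> 0"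
  shows "0 < (\<Sum>i<n. \<Sum>j<n. v i * penalty_form G (\<psi> j) (\<psi> i) * v j)"
proof (rule ccontr)
  define M where "M = lebesgue_on (dg_domain G)"
  define U where "U x = (\<Sum>i<n. v i *\<^sub>R \<psi> i x)" for x
  have \<psi>: "\<psi> i \<in> dg_space G" "l2_fun M (\<psi> i)" "W \<in> conforming_space G \<Longrightarrow> l2_inner M (\<psi> i) W = 0"
    "j < n \<Longrightarrow> l2_inner M (\<psi> i) (\<psi> j) = (if i = j then 1 else 0)" if "i < n" for i j W
    using assms(2) that by (auto simp: l2_orthonormal_basis_def nonconforming_space_def dg_space_def M_def)
  assume "\<not> 0 < (\<Sum>i<n. \<Sum>j<n. v i * penalty_form G (\<psi> j) (\<psi> i) * v j)"
  then have "U \<in> conforming_space G"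
    using penalty_form_sum_nonneg[OF assms(1), of n \<psi> v] \<psi>(1) unfolding U_def[abs_def] by force
  \<comment> \<open>\<open>U\<close> is a combination of the \<open>\<psi> i\<close>, each
    orthogonal to the conforming function \<open>U\<close>; orthonormality then turns the zero norm
    into zero coefficients.\<close>
  then have "l2_inner M U U = 0"
    using \<psi> by (subst U_def[abs_def], subst l2_inner_sum_left)
      (auto simp: conforming_space_def dg_space_def M_def)
  moreover have "l2_inner M U U = (\<Sum>i<n. \<Sum>j<n. v i * l2_inner M (\<psi> i) (\<psi> j) * v j)"
    unfolding U_def[abs_def] using \<psi> by (intro l2_inner_sum_sum) auto
  moreover have "\<dots> = (\<Sum>i<n. \<Sum>j<n. if i = j then (v i)\<^sup>2 else 0)"
    by (intro sum.cong refl) (simp add: \<psi>(4) power2_eq_square)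
  ultimately have "(\<Sum>i<n. (v i)\<^sup>2) = 0" by simp
  then show False using assms(3) by (auto simp: sum_nonneg_eq_0_iff)
qed

theorem lemma3p1:
  fixes G :: "('d::finite, 'm::finite) dg_problem"
    and \<Phi> \<Psi> :: "nat \<Rightarrow> real^'d \<Rightarrow> real^'m"
    and NC NNC :: nat
    and \<mu> :: "nat \<Rightarrow> complex"
  assumes "dg_setting G"
    and "l2_orthonormal_basis (lebesgue_on (dg_domain G)) (conforming_space G) NC \<Phi>"
    and "l2_orthonormal_basis (lebesgue_on (dg_domain G)) (nonconforming_space G) NNC \<Psi>"
    and "eigenvalue_mset (conforming_matrix G NC \<Phi>) = image_mset \<mu> (mset_set {..<NC})"
  shows "\<exists>evC evNC :: real \<Rightarrow> nat \<Rightarrow> complex.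
    (\<forall>\<^sub>F \<tau> in at_top.
       eigenvalue_mset (dg_matrix G NC \<Phi> NNC \<Psi> \<tau>) =
         image_mset (evC \<tau>) (mset_set {..<NC}) + image_mset (evNC \<tau>) (mset_set {..<NNC}) \<and>
       evC \<tau> ` {..<NC} \<inter> evNC \<tau> ` {..<NNC} = {}) \<and>
    (\<forall>i<NNC. filterlim (\<lambda>\<tau>. Re (evNC \<tau> i)) at_bot at_top \<and>
             (\<lambda>\<tau>. \<bar>Re (evNC \<tau> i)\<bar>) \<in> O[at_top](\<lambda>\<tau>. \<tau>)) \<and>
    (\<forall>j<NC. (\<lambda>\<tau>. cmod (evC \<tau> j - \<mu> j)) \<in> O[at_top](\<lambda>\<tau>. 1 / \<tau>))"
proof -
  define b where "b = combined_basis NC \<Phi> \<Psi>"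
  \<comment> \<open>The column index belongs to the trial function, so the arguments are swapped as
    in \<open>dg_matrix\<close>.\<close>
  define K where "K i j = dg_form G 0 (b j) (b i)" for i j
  \<comment> \<open>The zeros agree with the penalty form because functions in the conforming space
    have no normal jumps.\<close>
  define S where "S i j = (if i < NC \<or> j < NC then 0 else penalty_form G (b j) (b i))" for i j
  have conf: "b i \<in> conforming_space G" if "i < NC" for i
    using assms(2) that by (simp add: b_def combined_basis_def l2_orthonormal_basis_def)
  have b_NC: "b (NC + i) = \<Psi> i" for i by (simp add: b_def combined_basis_def)
  have "dg_form G \<tau> (b j) (b i) = K i j - \<tau> * S i j" for \<tau> i j
    using conf[of i] conf[of j]
    by (subst dg_form_split) (simp add: K_def S_def penalty_form_conforming)
  then have "map_mat complex_of_real (dg_matrix G NC \<Phi> NNC \<Psi> \<tau>) =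
      Matrix.mat (NC + NNC) (NC + NNC) (\<lambda>(i, j). complex_of_real (K i j - \<tau> * S i j))" for \<tau>
    by (intro eq_matI) (auto simp: dg_matrix_def b_def)
  then have M: "eigenvalue_mset (dg_matrix G NC \<Phi> NNC \<Psi> \<tau>) = proots (char_poly
      (Matrix.mat (NC + NNC) (NC + NNC) (\<lambda>(i, j). complex_of_real (K i j - \<tau> * S i j))))" for \<tau>
    by (simp add: eigenvalue_mset_def)
  have "volume_form G (\<Phi> j) (\<Phi> i) = K i j" if "i < NC" "j < NC" for i j
    using dg_form_conforming[OF conf[OF that(2)] conf[OF that(1)]] that
    by (simp add: K_def b_def combined_basis_def)
  then have "map_mat complex_of_real (conforming_matrix G NC \<Phi>) =
      Matrix.mat NC NC (\<lambda>(i, j). complex_of_real (K i j))"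
    by (intro eq_matI) (auto simp: conforming_matrix_def)
  then have A: "proots (char_poly (Matrix.mat NC NC (\<lambda>(i, j). complex_of_real (K i j)))) = image_mset \<mu> (mset_set {..<NC})"
    using assms(4) by (simp add: eigenvalue_mset_def)
  show ?thesis unfolding M
  proof (rule penalised_spectrum_decouples[OF _ _ _ A])
    have "\<And>i. transpose (dg_coeff G i) = dg_coeff G i"
      using assms(1) by (simp add: dg_setting_def)
    then show "\<forall>i<NC + NNC. \<forall>j<NC + NNC. K i j = - K j i"
      unfolding K_def using dg_form_skew by blast
    show "S i j = 0" if "i < NC \<or> j < NC" for i j using that by (simp add: S_def)
    show "0 < (\<Sum>i<NNC. \<Sum>j<NNC. v i * S (NC + i) (NC + j) * v j)" if "\<exists>i<NNC. v i \<noteq> 0" for v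
      using penalty_form_pos[OF assms(1,3) that] by (simp add: S_def b_NC)
  qed
qed

end
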